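(* Let $T_1$ and $T_2$ be finite trees such that $S_{T_1}(q,r) = S_{T_2}(q,r)$, where $S_T(q,r)$ denotes the bivariate subtree polynomial of a tree $T$. Then: (1) the trunks of $T_1$ and $T_2$ have the same size, i.e. $|V(T_1^{\circ})| = |V(T_2^{\circ})|$; and (2) the multiset of lengths of the twigs of $T_1$ equals the multiset of lengths of the twigs of $T_2$, i.e. for every integer $i \geq 1$, the number of twigs of length $i$ in $T_1$ equals the number of twigs of length $i$ in $T_2$. Consequently, the same two conclusions (1) and (2) hold for any finite trees $T_1$ and $T_2$ with equal chromatic symmetric functions $X_{T_1} = X_{T_2}$.
   Context: All graphs are finite and simple. A tree is a connected graph with no cycles. The degree $d(v)$ of a vertex is the number of edges having $v$ as an endpoint. A vertex of degree $1$ in a tree is a leaf. A path is a nonempty sequence of edges $v_1v_2, v_2v_3, \dots, v_{k-1}v_k$ with the $v_i$ pairwise distinct; $v_1$ and $v_k$ are its endpoints, the other $v_i$ are its interior vertices, and its length is its number of edges. A path is identified with its reversal (i.e. with the subgraph it forms). A subtree of a tree $T$ is a connected induced subgraph of $T$ with at least one edge. The bivariate subtree polynomial of $T$ is $$S_T(q,r) = \sum_{\text{subtrees } S \text{ of } T} q^{|E(S)|} r^{|L(S)|},$$ where $L(S)$ is the set of leaves of $S$ (vertices of degree $1$ in $S$, which need not be leaves of $T$). The chromatic symmetric function of a graph $G$ is the formal power series in commuting variables $x_1, x_2, \dots$ $$X_G(x_1,x_2,\dots) = \sum_{\kappa} \prod_{v \in V(G)} x_{\kappa(v)},$$ where the sum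 ranges over all proper colorings $\kappa : V(G) \to \mathbb{Z}^+$, i.e. maps with $\kappa(v_1) \neq \kappa(v_2)$ whenever $v_1v_2 \in E(G)$. The trunk $T^{\circ}$ of a tree $T$ is the smallest connected induced subgraph of $T$ that contains all vertices of degree at least $3$ in $T$ (it is the empty graph, of size $0$, if $T$ has no vertex of degree at least $3$). The size of the trunk is its number of vertices. For a leaf $l$ of $T$, its twig $\hat{l}$ is the longest path $P$ in $T$ containing $l$ such that every interior vertex of $P$ has degree $2$ in $T$. A path of $T$ is called a twig of $T$ if it is the twig of some leaf of $T$. The twigs of $T$ are counted as distinct paths (so if $T$ is itself a path with at least one edge, it has exactly one twig, namely $T$). *)

theory Defs
  imports
    "HOL-Library.FuncSet"
    "HOL-Library.Multiset"
    "HOL-Library.Poly_Mapping"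
    "HOL-Computational_Algebra.Polynomial"
begin

record 'a ugraph =
  verts :: "'a set"
  edges :: "'a set set"

definition simple_graph :: "'a ugraph \<Rightarrow> bool" where
  "simple_graph G \<longleftrightarrow>
     finite (verts G) \<and> (\<forall>e\<in>edges G. e \<subseteq> verts G \<and> card e = 2)"

definition degree_of :: "'a ugraph \<Rightarrow> 'a \<Rightarrow> nat" where
  "degree_of G v = card {e \<in> edges G. v \<in> e}"

definition leaves :: "'a ugraph \<Rightarrow> 'a set" where
  "leaves G = {v \<in> verts G. degree_of G v = 1}"

definition induced :: "'a ugraph \<Rightarrow> 'a set \<Rightarrow> 'a ugraph" where
  "induced G U = \<lparr>verts = U, edges = {e \<in> edges G. e \<subseteq> U}\<rparr>"

definition connected_graph :: "'a ugraph \<Rightarrow> bool" where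
  "connected_graph G \<longleftrightarrow> verts G \<noteq> {} \<and>
     (\<forall>u\<in>verts G. \<forall>v\<in>verts G. (u, v) \<in> {(x, y). {x, y} \<in> edges G}\<^sup>*)"

definition is_cycle :: "'a ugraph \<Rightarrow> 'a list \<Rightarrow> bool" where
  "is_cycle G vs \<longleftrightarrow> length vs \<ge> 3 \<and> distinct vs \<and>
     successively (\<lambda>u v. {u, v} \<in> edges G) vs \<and> {last vs, hd vs} \<in> edges G"

definition is_tree :: "'a ugraph \<Rightarrow> bool" where
  "is_tree T \<longleftrightarrow> simple_graph T \<and> connected_graph T \<and> \<not> (\<exists>vs. is_cycle T vs)"

definition subtrees :: "'a ugraph \<Rightarrow> 'a ugraph set" where
  "subtrees T = {S. \<exists>U \<subseteq> verts T. S = induced T U \<and> connected_graph S \<and> edges S \<noteq> {}}"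

text \<open>The bivariate polynomial lives in \<open>\<int>[r][q]\<close>: the outer variable is \<open>q\<close>,
  the variable of the coefficients is \<open>r\<close>.\<close>

definition subtree_poly :: "'a ugraph \<Rightarrow> int poly poly" where
  "subtree_poly T =
     (\<Sum>S\<in>subtrees T. monom (monom 1 (card (leaves S))) (card (edges S)))"

definition proper_colorings :: "'a ugraph \<Rightarrow> ('a \<Rightarrow> nat) set" where
  "proper_colorings G =
     {\<kappa> \<in> verts G \<rightarrow>\<^sub>E {1..}. \<forall>u v. {u, v} \<in> edges G \<longrightarrow> \<kappa> u \<noteq> \<kappa> v}"

definition coloring_monomial :: "'a ugraph \<Rightarrow> ('a \<Rightarrow> nat) \<Rightarrow> (nat \<Rightarrow>\<^sub>0 nat)" where
  "coloring_monomial G \<kappa> = (\<Sum>v\<in>verts G. Poly_Mapping.single (\<kappa> v) 1)"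

text \<open>A formal power series in \<open>x\<^sub>1, x\<^sub>2, \<dots>\<close> is given by its coefficient function on
  monomials, and a monomial by its finitely supported exponent vector. The infinite formal
  sum over all proper colorings is taken coefficientwise: the coefficient of a monomial is
  the number of proper colorings contributing it, which is finite by the lemma below.\<close>

definition chromatic_symmetric :: "'a ugraph \<Rightarrow> (nat \<Rightarrow>\<^sub>0 nat) \<Rightarrow> int" where
  "chromatic_symmetric G m =
     int (card {\<kappa> \<in> proper_colorings G. coloring_monomial G \<kappa> = m})"

lemma finite_colorings_with_monomial:
  assumes "simple_graph G"
  shows "finite {\<kappa> \<in> proper_colorings G. coloring_monomial G \<kappa> = m}"
proof (rule finite_subset)
  have fin: "finite (verts G)"
    using assms by (simp add: simple_graph_def)
  show "finite (verts G \<rightarrow>\<^sub>E Poly_Mapping.keys m)"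
    using fin by (intro finite_PiE finite_keys)
  show "{\<kappa> \<in> proper_colorings G. coloring_monomial G \<kappa> = m} \<subseteq> verts G \<rightarrow>\<^sub>E Poly_Mapping.keys m"
  proof
    fix \<kappa> assume \<kappa>: "\<kappa> \<in> {\<kappa> \<in> proper_colorings G. coloring_monomial G \<kappa> = m}"
    have "\<kappa> v \<in> Poly_Mapping.keys m" if v: "v \<in> verts G" for v
    proof -
      have "Poly_Mapping.lookup m (\<kappa> v) = (\<Sum>w\<in>verts G. Poly_Mapping.lookup (Poly_Mapping.single (\<kappa> w) (1::nat)) (\<kappa> v))"
        using \<kappa> by (auto simp: coloring_monomial_def Poly_Mapping.lookup_sum)
      also have "\<dots> \<ge> Poly_Mapping.lookup (Poly_Mapping.single (\<kappa> v) (1::nat)) (\<kappa> v)"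
        using fin v by (intro member_le_sum) auto
      finally show ?thesis
        by (simp add: Poly_Mapping.in_keys_iff)
    qed
    with \<kappa> show "\<kappa> \<in> verts G \<rightarrow>\<^sub>E Poly_Mapping.keys m"
      by (auto simp: proper_colorings_def PiE_iff)
  qed
qed

text \<open>\<open>LEAST\<close> is with respect to inclusion of vertex sets; the minimum exists in a tree since
  there intersecting connected vertex sets have connected intersection.\<close>

definition trunk :: "'a ugraph \<Rightarrow> 'a ugraph" where
  "trunk T = (let D = {v \<in> verts T. degree_of T v \<ge> 3} in
     induced T (if D = {} then {}
                else LEAST U. U \<subseteq> verts T \<and> connected_graph (induced T U) \<and> D \<subseteq> U))"

definition is_path :: "'a ugraph \<Rightarrow> 'a list \<Rightarrow> bool" where
  "is_path G vs \<longleftrightarrow> length vs \<ge> 2 \<and> distinct vs \<and> set vs \<subseteq> verts G \<and>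
     successively (\<lambda>u v. {u, v} \<in> edges G) vs"

definition interior_verts :: "'a list \<Rightarrow> 'a set" where
  "interior_verts vs = set (butlast (tl vs))"

text \<open>Passing from a vertex sequence to its subgraph identifies a path with its reversal.\<close>

definition path_graph :: "'a list \<Rightarrow> 'a ugraph" where
  "path_graph vs = \<lparr>verts = set vs, edges = {{vs ! i, vs ! Suc i} | i. Suc i < length vs}\<rparr>"

definition is_twig_of :: "'a ugraph \<Rightarrow> 'a \<Rightarrow> 'a list \<Rightarrow> bool" where
  "is_twig_of T l = is_arg_max length
     (\<lambda>vs. is_path T vs \<and> l \<in> set vs \<and> (\<forall>v\<in>interior_verts vs. degree_of T v = 2))"

definition twigs :: "'a ugraph \<Rightarrow> 'a ugraph set" where
  "twigs T = {path_graph vs | l vs. l \<in> leaves T \<and> is_twig_of T l vs}"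

definition twig_lengths :: "'a ugraph \<Rightarrow> nat multiset" where
  "twig_lengths T = image_mset (\<lambda>P. card (edges P)) (mset_set (twigs T))"

end

theory Submission imports Defs begin

text \<open>
For a connected vertex set \<open>U\<close> of a tree, counting degrees shows that the number of edges leaving
\<open>U\<close> is \<open>2 + (\<Sum>v\<in>U. deg v - 2)\<close>. Hence it is at most the number \<open>\<ell>\<close> of leaves of the tree, with
equality iff \<open>U\<close> contains all vertices of degree at least 3 and no leaf. Paths are recognized by
\<open>\<ell> = 2\<close>, so assume that there is a vertex of degree at least 3.
These \<open>U\<close> arise from the trunk by adding a proper initial piece of each twig, so with \<open>a\<^sub>i\<close> the twig
lengths they have generating function \<open>x ^ t * (\<Prod>i. 1 + x + \<dots> + x ^ (a\<^sub>i - 1))\<close>, where \<open>t\<close> is the size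
of the trunk. Multiplied by \<open>(1 - x) ^ \<ell>\<close> it becomes \<open>x ^ t * (\<Prod>i. 1 - x ^ a\<^sub>i)\<close>, which determines \<open>t\<close>
and the multiset of the \<open>a\<^sub>i\<close>. In the same way the subtrees with \<open>\<ell>\<close> leaves have this generating
function times \<open>x ^ \<ell>\<close>, so the subtree polynomial suffices.

The chromatic symmetric function counts the proper colorings with \<open>y\<close> plain and \<open>z\<close> special colors in
which \<open>k\<close> vertices get a special color. The induced forests on the special and the plain vertices have
chromatic polynomials depending only on their numbers of vertices and edges. The coefficient of \<open>z\<close>
isolates the connected special sets, and as a function of \<open>y\<close> it reveals how many of them have a given
number of leaving edges.
\<close>

subsection \<open>Forests and connected vertex sets\<close>

definition nbrs :: "'a ugraph \<Rightarrow> 'a \<Rightarrow> 'a set" where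
  "nbrs G v = {w. {v, w} \<in> edges G}"

definition forest :: "'a ugraph \<Rightarrow> bool" where
  "forest G \<longleftrightarrow> simple_graph G \<and> \<not> (\<exists>vs. is_cycle G vs)"

definition edges_in :: "'a ugraph \<Rightarrow> 'a set \<Rightarrow> 'a set set" where
  "edges_in G U = {e \<in> edges G. e \<subseteq> U}"

lemma nbrs_sym: "w \<in> nbrs G v \<longleftrightarrow> v \<in> nbrs G w"
  by (simp add: nbrs_def insert_commute)

lemma nbrs_verts: "simple_graph G \<Longrightarrow> w \<in> nbrs G v \<Longrightarrow> w \<in> verts G \<and> v \<in> verts G \<and> v \<noteq> w"
  unfolding simple_graph_def nbrs_def by (auto dest!: bspec)

lemma finite_nbrs: "simple_graph G \<Longrightarrow> finite (nbrs G v)"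
  by (rule finite_subset[of _ "verts G"]) (auto simp: nbrs_def simple_graph_def)

lemma finite_edges: "simple_graph G \<Longrightarrow> finite (edges G)"
  by (rule finite_subset[of _ "Pow (verts G)"]) (auto simp: simple_graph_def)

lemma simple_edgeE:
  assumes "simple_graph G" "e \<in> edges G"
  obtains u v where "e = {u, v}" "u \<noteq> v" "v \<in> nbrs G u"
  using assms unfolding simple_graph_def nbrs_def by (metis card_2_iff mem_Collect_eq)

lemma edges_at: "simple_graph G \<Longrightarrow> {e \<in> edges G. v \<in> e} = (\<lambda>w. {v, w}) ` nbrs G v"
proof (intro equalityI subsetI)
  fix e assume s: "simple_graph G" and "e \<in> {e \<in> edges G. v \<in> e}"
  then have e: "e \<in> edges G" "v \<in> e" by auto
  obtain x y where "e = {x, y}" using simple_edgeE[OF s e(1)] by metis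
  then show "e \<in> (\<lambda>w. {v, w}) ` nbrs G v"
    using e by (auto simp: nbrs_def insert_commute)
qed (auto simp: nbrs_def)

lemma inj_doubleton: "inj_on (\<lambda>w. {v, w}) A"
  by (auto simp: inj_on_def doubleton_eq_iff)

lemma degree_of_eq_card_nbrs: "simple_graph G \<Longrightarrow> degree_of G v = card (nbrs G v)"
  by (simp add: degree_of_def edges_at card_image inj_doubleton)

lemma induced_simps [simp]:
  "verts (induced G U) = U" "edges (induced G U) = edges_in G U"
  by (simp_all add: induced_def edges_in_def)

lemma induced_verts: "simple_graph G \<Longrightarrow> induced G (verts G) = G"
  by (cases G) (auto simp: induced_def simple_graph_def)

lemma edges_in_verts: "simple_graph G \<Longrightarrow> edges_in G (verts G) = edges G"
  by (auto simp: edges_in_def simple_graph_def)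

lemma simple_induced: "simple_graph G \<Longrightarrow> U \<subseteq> verts G \<Longrightarrow> simple_graph (induced G U)"
  by (auto simp: simple_graph_def edges_in_def finite_subset)

lemma nbrs_induced: "v \<in> U \<Longrightarrow> nbrs (induced G U) v = nbrs G v \<inter> U"
  by (auto simp: nbrs_def edges_in_def)

lemma forest_induced:
  assumes "forest G" "U \<subseteq> verts G" shows "forest (induced G U)"
proof -
  have "is_cycle G vs" if "is_cycle (induced G U) vs" for vs
    using that unfolding is_cycle_def by (auto simp: edges_in_def elim: successively_mono)
  then show ?thesis using assms simple_induced by (auto simp: forest_def)
qed

text \<open>A walk from inside \<open>A\<close> to outside must cross the cut; conversely, the set
  reachable from a vertex has no outgoing edge within \<open>U\<close>. In this form, adding or
  deleting a vertex only needs cases on \<open>A\<close>, with no walks to reroute.\<close>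

lemma connected_induced_iff_cut:
  "connected_graph (induced G U) \<longleftrightarrow>
    U \<noteq> {} \<and> (\<forall>A. A \<noteq> {} \<longrightarrow> A \<subset> U \<longrightarrow> (\<exists>a\<in>A. \<exists>b\<in>U - A. b \<in> nbrs G a))"
  (is "_ \<longleftrightarrow> U \<noteq> {} \<and> ?cut")
proof -
  let ?r = "{(x, y). {x, y} \<in> edges_in G U}"
  have "\<exists>a\<in>A. \<exists>b\<in>U - A. b \<in> nbrs G a"
    if c: "\<forall>u\<in>U. \<forall>v\<in>U. (u, v) \<in> ?r\<^sup>*" and A: "A \<noteq> {}" "A \<subset> U" for A
  proof (rule ccontr)
    assume no: "\<not> ?thesis"
    from A obtain u v where uv: "u \<in> A" "v \<in> U - A" by blast
    have "(u, v) \<in> ?r\<^sup>*" using c uv A by blast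
    then have "v \<in> A"
    proof induction
      case (step y z)
      then show ?case using no by (force simp: edges_in_def nbrs_def)
    qed (use uv in simp)
    then show False using uv by blast
  qed
  moreover have "\<forall>u\<in>U. \<forall>v\<in>U. (u, v) \<in> ?r\<^sup>*" if cut: ?cut
  proof (intro ballI, rule ccontr)
    fix u v assume u: "u \<in> U" and v: "v \<in> U" and no: "(u, v) \<notin> ?r\<^sup>*"
    let ?A = "{w \<in> U. (u, w) \<in> ?r\<^sup>*}"
    have "?A \<noteq> {}" "?A \<subset> U" using u v no by auto
    then have "\<exists>a\<in>?A. \<exists>b\<in>U - ?A. b \<in> nbrs G a" using cut by (metis (lifting))
    then obtain a b where ab: "a \<in> ?A" "b \<in> U - ?A" "b \<in> nbrs G a" by blast
    then have "(a, b) \<in> ?r" by (auto simp: edges_in_def nbrs_def)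
    then have "(u, b) \<in> ?r\<^sup>*" using ab(1) by (auto intro: rtrancl_into_rtrancl)
    then show False using ab by blast
  qed
  ultimately show ?thesis unfolding connected_graph_def induced_simps by blast
qed

lemma length_path_le: "simple_graph G \<Longrightarrow> is_path G vs \<Longrightarrow> length vs \<le> card (verts G)"
  unfolding is_path_def simple_graph_def by (metis card_mono distinct_card)

text \<open>The first vertex of a longest path has only its successor as a neighbor: any other would
  prolong the path or, if already on it, close a cycle.\<close>

lemma forest_has_leaf:
  assumes "forest G" "edges G \<noteq> {}"
  obtains v where "v \<in> verts G" "card (nbrs G v) = 1"
proof -
  have sg: "simple_graph G" using assms by (simp add: forest_def)
  obtain u v where uv: "u \<noteq> v" "v \<in> nbrs G u" using assms sg by (metis all_not_in_conv simple_edgeE)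
  then have "is_path G [u, v]" using nbrs_verts[OF sg uv(2)] by (auto simp: is_path_def nbrs_def)
  then obtain vs where vs: "is_path G vs" and max: "\<And>ys. is_path G ys \<Longrightarrow> length ys \<le> length vs"
    using ex_has_greatest_nat[of "is_path G" _ length "Suc (card (verts G))"] length_path_le[OF sg]
    by (metis le_imp_less_Suc)
  obtain x y zs where vs_eq: "vs = x # y # zs"
    using vs by (cases vs; cases "tl vs") (auto simp: is_path_def)
  have xy: "y \<in> nbrs G x" using vs by (simp add: is_path_def vs_eq nbrs_def)
  have "z = y" if z: "z \<in> nbrs G x" for z
  proof (rule ccontr)
    assume "z \<noteq> y"
    note zx = nbrs_verts[OF sg z]
    show False
    proof (cases "z \<in> set vs")
      case False
      then have "is_path G (z # vs)" using vs z zx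
        by (auto simp: is_path_def vs_eq nbrs_def insert_commute)
      then show False using max by fastforce
    next
      case True
      \<comment> \<open>As \<open>z\<close> differs from \<open>x\<close> and \<open>y\<close>, it
        comes after them, so the piece up to \<open>z\<close> has the three vertices that a cycle
        requires.\<close>
      then obtain ps qs where pq: "zs = ps @ z # qs" using zx \<open>z \<noteq> y\<close>
        by (auto simp: vs_eq dest: split_list)
      have "vs = (x # y # ps @ [z]) @ qs" by (simp add: vs_eq pq)
      then have "distinct (x # y # ps @ [z])"
          "successively (\<lambda>u v. {u, v} \<in> edges G) (x # y # ps @ [z])"
        using vs by (metis is_path_def distinct_append, metis is_path_def successively_append_iff)
      then have "is_cycle G (x # y # ps @ [z])" using z
        by (simp add: is_cycle_def nbrs_def insert_commute)
      then show False using assms(1) by (auto simp: forest_def)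
    qed
  qed
  then have "nbrs G x = {y}" using xy by blast
  then show thesis using that[of x] nbrs_verts[OF sg xy] by simp
qed

lemma edges_in_remove:
  assumes "simple_graph G" "v \<in> U" "finite U"
  shows "card (edges_in G U) = card (edges_in G (U - {v})) + card (nbrs G v \<inter> U)"
proof -
  have "edges_in G U = edges_in G (U - {v}) \<union> {e \<in> {e \<in> edges G. v \<in> e}. e \<subseteq> U}"
    by (auto simp: edges_in_def)
  also have "{e \<in> {e \<in> edges G. v \<in> e}. e \<subseteq> U} = (\<lambda>w. {v, w}) ` (nbrs G v \<inter> U)"
    unfolding edges_at[OF assms(1)] using assms(2) by auto
  finally have "edges_in G U = edges_in G (U - {v}) \<union> (\<lambda>w. {v, w}) ` (nbrs G v \<inter> U)" .
  moreover have "edges_in G (U - {v}) \<inter> (\<lambda>w. {v, w}) ` (nbrs G v \<inter> U) = {}"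
    by (auto simp: edges_in_def)
  moreover have "finite (edges_in G (U - {v}))"
    using finite_edges[OF assms(1)] by (simp add: edges_in_def)
  ultimately show ?thesis using assms
    by (simp add: card_Un_disjoint card_image inj_doubleton)
qed

text \<open>No connection passes through \<open>v\<close>. If \<open>A\<close> contains no neighbor
  of \<open>v\<close>, the edge crossing the cut \<open>A\<close> avoids \<open>v\<close>; if it
  contains the only one, an edge crossing \<open>insert v A\<close> cannot start at
  \<open>v\<close>.\<close>

lemma connected_remove:
  assumes "connected_graph (induced G U)" "simple_graph G" "U - {v} \<noteq> {}" "card (nbrs G v \<inter> U) \<le> 1"
  shows "connected_graph (induced G (U - {v}))"
  unfolding connected_induced_iff_cut
proof (intro conjI allI impI)
  fix A assume A: "A \<noteq> {}" "A \<subset> U - {v}"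
  have one: "w = w'" if "w \<in> nbrs G v \<inter> U" "w' \<in> nbrs G v \<inter> U" for w w'
    using assms(4) that finite_nbrs[OF assms(2)] card_le_Suc0_iff_eq[of "nbrs G v \<inter> U"] by auto
  have cut: "\<exists>a\<in>B. \<exists>b\<in>U - B. b \<in> nbrs G a" if "B \<noteq> {}" "B \<subset> U" for B
    using assms(1) that unfolding connected_induced_iff_cut by blast
  show "\<exists>a\<in>A. \<exists>b\<in>U - {v} - A. b \<in> nbrs G a"
  proof (cases "nbrs G v \<inter> U \<inter> A = {}")
    case True
    obtain a b where ab: "a \<in> A" "b \<in> U - A" "b \<in> nbrs G a" using cut[of A] A by blast
    then have "b \<noteq> v" using True A nbrs_sym[of b G a] by auto
    then show ?thesis using ab by blast
  next
    case False
    then obtain w where w: "w \<in> nbrs G v \<inter> U" "w \<in> A" by blast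
    show ?thesis
    proof (cases "v \<in> U")
      case True
      then obtain a b where ab: "a \<in> insert v A" "b \<in> U - insert v A" "b \<in> nbrs G a"
        using cut[of "insert v A"] A by blast
      then have "a \<noteq> v" using one[OF w(1), of b] w by auto
      then show ?thesis using ab by blast
    qed (use cut[of A] A in auto)
  qed
qed (use assms in auto)

lemma connected_insert:
  assumes "connected_graph (induced G U)" "u \<in> U" "v \<in> nbrs G u"
  shows "connected_graph (induced G (insert v U))"
  unfolding connected_induced_iff_cut
proof (intro conjI allI impI)
  fix A assume A: "A \<noteq> {}" "A \<subset> insert v U"
  have cut: "\<exists>a\<in>B. \<exists>b\<in>U - B. b \<in> nbrs G a" if "B \<noteq> {}" "B \<subset> U" for B
    using assms(1) that unfolding connected_induced_iff_cut by blast
  have uv: "u \<in> nbrs G v" using assms(3) by (simp add: nbrs_sym)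
  consider "A \<inter> U = {}" | "U \<subseteq> A" | "A \<inter> U \<noteq> {}" "A \<inter> U \<subset> U" by blast
  then show "\<exists>a\<in>A. \<exists>b\<in>insert v U - A. b \<in> nbrs G a"
  proof cases
    case 1 then show ?thesis using A assms(2) uv by auto
  next
    case 2 then show ?thesis using A assms(2,3) by auto
  next
    case 3 then show ?thesis using cut[of "A \<inter> U"] by blast
  qed
qed simp

text \<open>Deleting a leaf of the induced forest removes one vertex and one edge and affects
  connectedness in neither direction; without edges, connected means a single vertex. Connectedness
  thereby becomes a numerical condition.\<close>

lemma forest_card_edges:
  assumes "forest G" "finite U" "U \<subseteq> verts G" "U \<noteq> {}"
  shows "card (edges_in G U) + 1 \<le> card U \<and>
    (connected_graph (induced G U) \<longleftrightarrow> card (edges_in G U) + 1 = card U)"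
  using assms(2-)
proof (induction "card U" arbitrary: U)
  case (Suc k)
  have sg: "simple_graph G" using assms(1) by (simp add: forest_def)
  show ?case
  proof (cases "edges_in G U = {}")
    case True
    have "\<exists>v. U = {v}" if c: "connected_graph (induced G U)"
    proof -
      obtain v where v: "v \<in> U" using Suc.prems by blast
      show ?thesis
      proof (rule ccontr)
        assume "\<nexists>v. U = {v}"
        then have "{v} \<subset> U" using v by blast
        then obtain b where "b \<in> U" "b \<in> nbrs G v" using c unfolding connected_induced_iff_cut by blast
        then have "{v, b} \<in> edges_in G U" using v by (simp add: nbrs_def edges_in_def)
        then show False using True by blast
      qed
    qed
    moreover have "connected_graph (induced G U)" if "card U = 1"
      using that unfolding connected_induced_iff_cut by (auto simp: card_1_singleton_iff)
    moreover have "card U \<ge> 1" using Suc by simp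
    ultimately show ?thesis using True by (metis Suc_eq_plus1 card.empty is_singletonI is_singleton_altdef plus_nat.add_0)
  next
    case False
    obtain v where v: "v \<in> U" "card (nbrs (induced G U) v) = 1"
      using forest_has_leaf[OF forest_induced[OF assms(1) Suc.prems(2)]] False by auto
    then have one: "card (nbrs G v \<inter> U) = 1" by (simp add: nbrs_induced)
    then obtain u where u: "nbrs G v \<inter> U = {u}" by (auto simp: card_1_singleton_iff)
    then have uU: "u \<in> U - {v}" and vu: "v \<in> nbrs G u" using nbrs_verts[OF sg] by (auto simp: nbrs_sym[of v G])
    have k: "card (U - {v}) = k" using Suc.hyps(2) v Suc.prems by simp
    have IH: "card (edges_in G (U - {v})) + 1 \<le> card (U - {v}) \<and>
      (connected_graph (induced G (U - {v})) \<longleftrightarrow> card (edges_in G (U - {v})) + 1 = card (U - {v}))"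
      using Suc.hyps(1)[of "U - {v}"] k Suc.prems uU by blast
    have "connected_graph (induced G U) \<longleftrightarrow> connected_graph (induced G (U - {v}))"
      using connected_remove[of G U v] connected_insert[of G "U - {v}" u v] sg one uU vu v
      by (auto simp: insert_absorb)
    then show ?thesis
      using IH edges_in_remove[OF sg v(1) Suc.prems(1)] one k Suc.hyps(2) by auto
  qed
qed simp

lemma sum_card_nbrs:
  assumes "simple_graph G" "U \<subseteq> verts G"
  shows "(\<Sum>v\<in>U. card (nbrs G v)) =
    2 * card (edges_in G U) + card {e \<in> edges G. card (e \<inter> U) = 1}"
proof -
  have fE: "finite (edges G)" and fU: "finite U"
    using assms finite_edges by (auto simp: simple_graph_def finite_subset)
  have "(\<Sum>v\<in>U. card (nbrs G v)) = (\<Sum>v\<in>U. \<Sum>e\<in>edges G. if v \<in> e then 1 else 0)"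
    using assms(1) fE by (auto simp: degree_of_eq_card_nbrs[symmetric] degree_of_def sum.If_cases
        intro!: sum.cong arg_cong[of _ _ card])
  also have "\<dots> = (\<Sum>e\<in>edges G. card (e \<inter> U))"
    unfolding sum.swap[of _ _ U] using fU
    by (intro sum.cong refl) (simp add: sum.If_cases Int_def conj_commute)
  also have "\<dots> = (\<Sum>e\<in>edges G. (if e \<subseteq> U then 2 else 0) + (if card (e \<inter> U) = 1 then 1 else 0))"
  proof (rule sum.cong)
    fix e assume e: "e \<in> edges G"
    then obtain u v where "e = {u, v}" "u \<noteq> v" using simple_edgeE[OF assms(1)] by metis
    then show "card (e \<inter> U) = (if e \<subseteq> U then 2 else 0) + (if card (e \<inter> U) = 1 then 1 else 0)"
      by (auto simp: Int_insert_left)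
  qed simp
  also have "\<dots> = 2 * card (edges_in G U) + card {e \<in> edges G. card (e \<inter> U) = 1}"
    using fE by (simp add: sum.distrib sum.If_cases edges_in_def Int_def)
  finally show ?thesis .
qed

subsection \<open>Colorings of forests\<close>

lemma poly_eq_if_infinitely_many:
  fixes p q :: "real poly"
  assumes "infinite S" "\<And>x. x \<in> S \<Longrightarrow> poly p x = poly q x"
  shows "p = q"
proof (rule ccontr)
  assume "p \<noteq> q"
  then have "finite {x. poly (p - q) x = 0}" by (intro poly_roots_finite) simp
  then have "finite S" by (rule rev_finite_subset) (use assms(2) in auto)
  then show False using assms(1) by simp
qed

definition cols :: "'a ugraph \<Rightarrow> 'a set \<Rightarrow> nat set \<Rightarrow> ('a \<Rightarrow> nat) set" where
  "cols G U C = {\<kappa> \<in> U \<rightarrow>\<^sub>E C. \<forall>u\<in>U. \<forall>v\<in>U. v \<in> nbrs G u \<longrightarrow> \<kappa> u \<noteq> \<kappa> v}"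

lemma finite_cols: "finite U \<Longrightarrow> finite C \<Longrightarrow> finite (cols G U C)"
  by (simp add: cols_def finite_PiE)

text \<open>Once the other vertices are colored, the only constraint on \<open>v\<close> is to avoid
  the color of its single neighbor \<open>w\<close>. Hence the bijection with pairs of a coloring of
  the rest and a color other than that of \<open>w\<close>.\<close>

lemma card_cols_remove_leaf:
  assumes "simple_graph G" "finite U" "finite C" "v \<in> U" "nbrs G v \<inter> U = {w}"
  shows "card (cols G U C) = card (cols G (U - {v}) C) * (card C - 1)"
proof -
  have w: "w \<in> U - {v}" using assms(4,5) nbrs_verts[OF assms(1), of w v] by auto
  let ?f = "\<lambda>\<kappa>. (restrict \<kappa> (U - {v}), \<kappa> v)"
  let ?g = "\<lambda>(\<kappa>, x). \<kappa>(v := x)"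
  have nb: "u = w" if "u \<in> U" "v \<in> nbrs G u \<or> u \<in> nbrs G v" for u
    using that assms(5) nbrs_sym[of v G u] by auto
  have irr: "v \<notin> nbrs G v" using nbrs_verts[OF assms(1), of v v] by auto
  have vw: "w \<in> nbrs G v" using assms(5) by auto
  have "bij_betw ?f (cols G U C) (SIGMA \<kappa>:cols G (U - {v}) C. C - {\<kappa> w})"
  proof (rule bij_betw_byWitness[where f' = ?g])
    show "\<forall>\<kappa>\<in>cols G U C. ?g (?f \<kappa>) = \<kappa>"
      using assms(4) by (auto simp: cols_def fun_eq_iff PiE_def extensional_def)
    show "\<forall>p\<in>SIGMA \<kappa>:cols G (U - {v}) C. C - {\<kappa> w}. ?f (?g p) = p"
      by (auto simp: cols_def fun_eq_iff PiE_def extensional_def restrict_def)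
    show "?f ` cols G U C \<subseteq> (SIGMA \<kappa>:cols G (U - {v}) C. C - {\<kappa> w})"
      using assms(4) w vw by (fastforce simp: cols_def dest: PiE_mem)
    show "?g ` (SIGMA \<kappa>:cols G (U - {v}) C. C - {\<kappa> w}) \<subseteq> cols G U C"
    proof (rule image_subsetI)
      fix p assume "p \<in> (SIGMA \<kappa>:cols G (U - {v}) C. C - {\<kappa> w})"
      then obtain \<kappa> x where p: "p = (\<kappa>, x)" and k: "\<kappa> \<in> cols G (U - {v}) C"
        and x: "x \<in> C" "x \<notin> {\<kappa> w}" by auto
      have "\<kappa>(v := x) \<in> U \<rightarrow>\<^sub>E C"
        using k x(1) assms(4) by (auto simp: cols_def PiE_def extensional_def Pi_def)
      moreover have "(\<kappa>(v := x)) a \<noteq> (\<kappa>(v := x)) b" if "a \<in> U" "b \<in> U" "b \<in> nbrs G a" for a b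
        using that k x irr nb[of a] nb[of b] w by (auto simp: cols_def)
      ultimately show "?g p \<in> cols G U C" by (simp add: cols_def p)
    qed
  qed
  then have "card (cols G U C) = (\<Sum>\<kappa>\<in>cols G (U - {v}) C. card (C - {\<kappa> w}))"
    using assms(2,3) by (simp add: bij_betw_same_card card_SigmaI finite_cols)
  also have "\<dots> = (\<Sum>\<kappa>\<in>cols G (U - {v}) C. card C - 1)"
    using w by (intro sum.cong refl card_Diff_singleton) (auto simp: cols_def)
  finally show ?thesis by simp
qed

text \<open>The chromatic polynomial of a forest; \<open>card U - card (edges_in G U)\<close> is its
  number of components. Each deleted leaf contributes \<open>card C - 1\<close>, and each vertex
  left isolated at the end \<open>card C\<close>.\<close>

lemma card_cols:
  assumes "forest G" "finite U" "U \<subseteq> verts G" "finite C"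
  shows "card (cols G U C) = card C ^ (card U - card (edges_in G U)) * (card C - 1) ^ card (edges_in G U)"
  using assms(2,3)
proof (induction "card U" arbitrary: U rule: less_induct)
  case less
  have sg: "simple_graph G" using assms(1) by (simp add: forest_def)
  show ?case
  proof (cases "edges_in G U = {}")
    case True
    then have "cols G U C = U \<rightarrow>\<^sub>E C" by (auto simp: cols_def nbrs_def edges_in_def)
    then show ?thesis using True less.prems by (simp add: card_PiE)
  next
    case False
    obtain v where v: "v \<in> U" "card (nbrs (induced G U) v) = 1"
      using forest_has_leaf[OF forest_induced[OF assms(1) less.prems(2)]] False by auto
    then obtain w where w: "nbrs G v \<inter> U = {w}" by (auto simp: nbrs_induced card_1_singleton_iff)
    have "card (U - {v}) < card U" using v less.prems by (meson card_Diff1_less)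
    then have "card (cols G (U - {v}) C) = card C ^ (card (U - {v}) - card (edges_in G (U - {v})))
        * (card C - 1) ^ card (edges_in G (U - {v}))"
      using less by blast
    moreover have "card (edges_in G U) = card (edges_in G (U - {v})) + 1"
      using edges_in_remove[OF sg v(1) less.prems(1)] w by simp
    moreover have "card U = Suc (card (U - {v}))"
      using v less.prems by (metis card_Suc_Diff1)
    ultimately show ?thesis using card_cols_remove_leaf[OF sg less.prems(1) assms(4) v(1) w]
      by simp
  qed
qed

text \<open>Colors in \<open>{1..y}\<close> are plain and those in \<open>{y<..y + z}\<close>
  special; exactly \<open>k\<close> vertices are special.\<close>

definition split_cols :: "'a ugraph \<Rightarrow> nat \<Rightarrow> nat \<Rightarrow> nat \<Rightarrow> ('a \<Rightarrow> nat) set" where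
  "split_cols G y z k = {\<kappa> \<in> cols G (verts G) {1..y + z}. card {v \<in> verts G. \<kappa> v > y} = k}"

lemma proper_colorings_eq_cols:
  "simple_graph G \<Longrightarrow> proper_colorings G = cols G (verts G) {1..}"
  using nbrs_verts[of G] by (fastforce simp: proper_colorings_def cols_def nbrs_def)

text \<open>\<open>U\<close> is the set of special vertices. Plain and special colors are disjoint,
  so edges between \<open>U\<close> and its complement impose nothing and the two sides are colored
  independently.\<close>

lemma card_split_cols:
  assumes "simple_graph G"
  shows "card (split_cols G y z k) =
    (\<Sum>U | U \<subseteq> verts G \<and> card U = k. card (cols G U {y<..y + z}) * card (cols G (verts G - U) {1..y}))"
proof -
  let ?V = "verts G"
  let ?F = "\<lambda>U. {\<kappa> \<in> cols G ?V {1..y + z}. {v \<in> ?V. \<kappa> v > y} = U}"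
  have fV: "finite ?V" using assms by (simp add: simple_graph_def)
  have "split_cols G y z k = (\<Union>U\<in>{U. U \<subseteq> ?V \<and> card U = k}. ?F U)"
    by (auto simp: split_cols_def)
  also have "card \<dots> = (\<Sum>U | U \<subseteq> ?V \<and> card U = k. card (?F U))"
    using fV by (intro card_UN_disjoint) (auto simp: finite_cols)
  also have "\<dots> = (\<Sum>U | U \<subseteq> ?V \<and> card U = k. card (cols G U {y<..y + z} \<times> cols G (?V - U) {1..y}))"
  proof (rule sum.cong[OF refl])
    fix U assume "U \<in> {U. U \<subseteq> ?V \<and> card U = k}"
    then have U: "U \<subseteq> ?V" by simp
    let ?f = "\<lambda>\<kappa>. (restrict \<kappa> U, restrict \<kappa> (?V - U))"
    let ?g = "\<lambda>(\<kappa>, \<mu>) x. if x \<in> U then \<kappa> x else \<mu> x"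
    have "bij_betw ?f (?F U) (cols G U {y<..y + z} \<times> cols G (?V - U) {1..y})"
    proof (rule bij_betw_byWitness[where f' = ?g])
      show "\<forall>\<kappa>\<in>?F U. ?g (?f \<kappa>) = \<kappa>"
        using U by (auto simp: cols_def fun_eq_iff PiE_def extensional_def)
      show "\<forall>p\<in>cols G U {y<..y + z} \<times> cols G (?V - U) {1..y}. ?f (?g p) = p"
        using U by (auto simp: cols_def fun_eq_iff PiE_def extensional_def restrict_def)
      show "?f ` ?F U \<subseteq> cols G U {y<..y + z} \<times> cols G (?V - U) {1..y}"
        using U by (auto simp: cols_def PiE_def Pi_def)
      show "?g ` (cols G U {y<..y + z} \<times> cols G (?V - U) {1..y}) \<subseteq> ?F U"
      proof (rule image_subsetI)
        fix p assume "p \<in> cols G U {y<..y + z} \<times> cols G (?V - U) {1..y}"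
        then obtain \<kappa> \<mu> where p: "p = (\<kappa>, \<mu>)"
          and k: "\<kappa> \<in> cols G U {y<..y + z}" and m: "\<mu> \<in> cols G (?V - U) {1..y}" by auto
        have kU: "y < \<kappa> v \<and> \<kappa> v \<le> y + z" if "v \<in> U" for v using that k by (auto simp: cols_def dest!: PiE_mem)
        have mU: "1 \<le> \<mu> v \<and> \<mu> v \<le> y" if "v \<in> ?V - U" for v using that m by (auto simp: cols_def dest!: PiE_mem)
        have mo: "\<mu> v = undefined" if "v \<notin> ?V" for v
          using that m by (auto simp: cols_def PiE_def extensional_def)
        have "?g p \<in> ?V \<rightarrow>\<^sub>E {1..y + z}"
          using U kU mU mo unfolding p by (fastforce simp: PiE_def extensional_def Pi_def)
        moreover have "?g p u \<noteq> ?g p v" if "u \<in> ?V" "v \<in> ?V" "v \<in> nbrs G u" for u v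
          using that k m kU[of u] kU[of v] mU[of u] mU[of v] unfolding p cols_def by auto
        moreover have "{v \<in> ?V. ?g p v > y} = U"
          using U kU mU unfolding p by (auto simp: not_less[symmetric] split: if_splits)
        ultimately show "?g p \<in> ?F U" unfolding cols_def by auto
      qed
    qed
    then show "card (?F U) = card (cols G U {y<..y + z} \<times> cols G (?V - U) {1..y})"
      by (rule bij_betw_same_card)
  qed
  finally show ?thesis by (simp add: card_cartesian_product)
qed

lemma lookup_coloring_monomial:
  "finite (verts G) \<Longrightarrow> Poly_Mapping.lookup (coloring_monomial G \<kappa>) c = card {v \<in> verts G. \<kappa> v = c}"
  by (simp add: coloring_monomial_def lookup_sum lookup_single when_def sum.If_cases Int_def conj_commute)

text \<open>Whether a proper coloring is counted depends only on its monomial, so grouping by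
  monomials expresses the count through \<open>chromatic_symmetric G\<close> alone. Omitting zero
  coefficients confines the sum to the finitely many monomials that occur.\<close>

lemma card_split_cols_chromatic:
  assumes "simple_graph G"
  shows "int (card (split_cols G y z k)) =
    (\<Sum>m | Poly_Mapping.keys m \<subseteq> {..y + z} \<and> (\<Sum>c\<in>{y<..y + z}. Poly_Mapping.lookup m c) = k \<and>
        chromatic_symmetric G m \<noteq> 0. chromatic_symmetric G m)"
proof -
  let ?V = "verts G" and ?M = "coloring_monomial G" and ?S = "split_cols G y z k"
  let ?Q = "\<lambda>m. Poly_Mapping.keys m \<subseteq> {..y + z} \<and> (\<Sum>c\<in>{y<..y + z}. Poly_Mapping.lookup m c) = k"
  have fV: "finite ?V" using assms by (simp add: simple_graph_def)
  have keys: "Poly_Mapping.keys (?M \<kappa>) = \<kappa> ` ?V" for \<kappa>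
    using fV by (auto simp: in_keys_iff lookup_coloring_monomial)
  have special: "(\<Sum>c\<in>{y<..y + z}. Poly_Mapping.lookup (?M \<kappa>) c) = card {v \<in> ?V. y < \<kappa> v \<and> \<kappa> v \<le> y + z}" for \<kappa>
  proof -
    have "(\<Sum>c\<in>{y<..y + z}. Poly_Mapping.lookup (?M \<kappa>) c) = card (\<Union>c\<in>{y<..y + z}. {v \<in> ?V. \<kappa> v = c})"
      using fV by (subst card_UN_disjoint) (auto simp: lookup_coloring_monomial)
    also have "(\<Union>c\<in>{y<..y + z}. {v \<in> ?V. \<kappa> v = c}) = {v \<in> ?V. y < \<kappa> v \<and> \<kappa> v \<le> y + z}" by auto
    finally show ?thesis .
  qed
  have "?S = {\<kappa> \<in> proper_colorings G. ?Q (?M \<kappa>)}"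
  proof (intro set_eqI)
    fix \<kappa>
    have "\<kappa> \<in> ?S \<longleftrightarrow> \<kappa> \<in> proper_colorings G \<and> \<kappa> ` ?V \<subseteq> {..y + z} \<and> card {v \<in> ?V. \<kappa> v > y} = k"
      unfolding split_cols_def proper_colorings_eq_cols[OF assms] cols_def PiE_def Pi_def by fastforce
    moreover have "{v \<in> ?V. y < \<kappa> v \<and> \<kappa> v \<le> y + z} = {v \<in> ?V. \<kappa> v > y}" if "\<kappa> ` ?V \<subseteq> {..y + z}"
      using that by auto
    ultimately show "\<kappa> \<in> ?S \<longleftrightarrow> \<kappa> \<in> {\<kappa> \<in> proper_colorings G. ?Q (?M \<kappa>)}"
      by (auto simp: keys special)
  qed
  then have fib: "{\<kappa> \<in> ?S. ?M \<kappa> = m} = {\<kappa> \<in> proper_colorings G. ?M \<kappa> = m}" if "?Q m" for m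
    using that by auto
  have fS: "finite ?S" using fV by (simp add: split_cols_def finite_cols)
  have im: "{m. ?Q m \<and> chromatic_symmetric G m \<noteq> 0} = ?M ` ?S"
    using finite_colorings_with_monomial[OF assms] \<open>?S = _\<close>
    by (auto simp: chromatic_symmetric_def)
  have "?S = (\<Union>m\<in>?M ` ?S. {\<kappa> \<in> ?S. ?M \<kappa> = m})" by auto
  then have "int (card ?S) = int (card (\<Union>m\<in>?M ` ?S. {\<kappa> \<in> ?S. ?M \<kappa> = m}))" by simp
  also have "\<dots> = (\<Sum>m\<in>?M ` ?S. int (card {\<kappa> \<in> ?S. ?M \<kappa> = m}))"
    using fS by (subst card_UN_disjoint) auto
  also have "\<dots> = (\<Sum>m | ?Q m \<and> chromatic_symmetric G m \<noteq> 0. chromatic_symmetric G m)"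
    unfolding im[symmetric] by (intro sum.cong) (auto simp: fib chromatic_symmetric_def)
  finally show ?thesis by (simp add: conj_assoc)
qed

text \<open>Without plain colors every vertex is special, so only \<open>k = card (verts G)\<close>
  is possible, and an injective coloring shows that it occurs. Thus the counts reveal the number of
  vertices.\<close>

lemma split_cols_all_special:
  assumes "simple_graph G"
  shows "split_cols G 0 (card (verts G)) (card (verts G)) \<noteq> {}"
    and "split_cols G 0 z k \<noteq> {} \<Longrightarrow> k = card (verts G)"
proof -
  have fV: "finite (verts G)" using assms by (simp add: simple_graph_def)
  then obtain h where h: "bij_betw h (verts G) {1..card (verts G)}"
    by (metis finite_atLeastAtMost finite_same_card_bij card_atLeastAtMost diff_Suc_1)
  then have "restrict h (verts G) \<in> cols G (verts G) {1..card (verts G)}"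
    using nbrs_verts[OF assms] by (fastforce simp: cols_def bij_betw_def inj_on_def)
  moreover have "{v \<in> verts G. \<kappa> v > 0} = verts G" if "\<kappa> \<in> cols G (verts G) {1..z}" for \<kappa> z
    using that by (fastforce simp: cols_def PiE_def Pi_def)
  ultimately show "split_cols G 0 (card (verts G)) (card (verts G)) \<noteq> {}"
    and "split_cols G 0 z k \<noteq> {} \<Longrightarrow> k = card (verts G)"
    by (auto simp: split_cols_def)
qed

subsection \<open>Boundaries of connected sets from the chromatic symmetric function\<close>

definition boundary :: "'a ugraph \<Rightarrow> 'a set \<Rightarrow> 'a set set" where
  "boundary G U = {e \<in> edges G. card (e \<inter> U) = 1}"

definition conn_sets :: "'a ugraph \<Rightarrow> 'a set set" where
  "conn_sets G = {U. U \<subseteq> verts G \<and> connected_graph (induced G U)}"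

lemma card_edges_partition:
  assumes "simple_graph G" "U \<subseteq> verts G"
  shows "card (edges G) = card (edges_in G U) + card (edges_in G (verts G - U)) + card (boundary G U)"
proof -
  have card: "card (e \<inter> U) = 1 \<longleftrightarrow> \<not> e \<subseteq> U \<and> \<not> e \<subseteq> verts G - U" if e: "e \<in> edges G" for e
  proof -
    obtain u v where "e = {u, v}" "u \<noteq> v" "v \<in> nbrs G u" using simple_edgeE[OF assms(1) e] .
    then show ?thesis using nbrs_verts[OF assms(1), of v u] by (auto simp: Int_insert_left)
  qed
  have e0: "{} \<notin> edges G" using assms(1) by (auto simp: simple_graph_def)
  have "edges G = (edges_in G U \<union> edges_in G (verts G - U)) \<union> boundary G U"
    using card by (auto simp: edges_in_def boundary_def)
  also have "card \<dots> = card (edges_in G U \<union> edges_in G (verts G - U)) + card (boundary G U)"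
    using finite_edges[OF assms(1)] card
    by (intro card_Un_disjoint) (auto simp: edges_in_def boundary_def)
  also have "card (edges_in G U \<union> edges_in G (verts G - U)) =
      card (edges_in G U) + card (edges_in G (verts G - U))"
    using finite_edges[OF assms(1)] e0
    by (intro card_Un_disjoint) (auto simp: edges_in_def, metis Diff_disjoint Int_greatest subset_empty)
  finally show ?thesis by simp
qed

lemma tree_forest: "is_tree T \<Longrightarrow> forest T"
  by (simp add: is_tree_def forest_def)

lemma tree_card_edges:
  assumes "is_tree T" shows "card (edges T) + 1 = card (verts T)"
proof -
  have "simple_graph T" "connected_graph T" using assms by (auto simp: is_tree_def)
  moreover from this have "finite (verts T)" "verts T \<noteq> {}"
    by (auto simp: simple_graph_def connected_graph_def)
  ultimately show ?thesis using forest_card_edges[OF tree_forest[OF assms], of "verts T"]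
    by (simp add: induced_verts edges_in_verts)
qed

definition boundary_poly :: "'a ugraph \<Rightarrow> nat \<Rightarrow> real poly" where
  "boundary_poly G k = (\<Sum>U | U \<in> conn_sets G \<and> card U = k. monom 1 (card (boundary G U)))"

text \<open>The number of colorings is \<open>z\<close> times a polynomial in the number \<open>z\<close> of special colors;
  at \<open>z = 0\<close> only connected sets of specially colored vertices survive.\<close>

lemma split_cols_poly:
  assumes "is_tree T" "k \<ge> 1" "y \<ge> 2"
  obtains R :: "real poly"
  where "\<And>z. z \<ge> 1 \<Longrightarrow> real (card (split_cols T y z k)) = real z * poly R (real z)"
    and "poly R 0 = (-1) ^ (k - 1) * (real y - 1) ^ (card (verts T) - k)
      * poly (boundary_poly T k) (real y / (real y - 1))"
proof
  let ?V = "verts T"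
  have sg: "simple_graph T" and fo: "forest T" using assms by (auto simp: is_tree_def tree_forest)
  have fV: "finite ?V" using sg by (simp add: simple_graph_def)
  let ?e = "\<lambda>U. card (edges_in T U)"
  let ?f = "\<lambda>U. real y ^ (card ?V - k - ?e (?V - U)) * (real y - 1) ^ ?e (?V - U)"
  let ?Us = "{U. U \<subseteq> ?V \<and> card U = k}"
  \<comment> \<open>The product of the two forest counts for each \<open>U\<close>, with one factor
    \<open>z\<close> taken out; this is possible since a nonempty forest has fewer edges than
    vertices.\<close>
  define R where "R = (\<Sum>U\<in>?Us. smult (?f U) (monom 1 (k - ?e U - 1) * [:-1, 1:] ^ ?e U))"
  have le: "?e U + 1 \<le> k" and conn: "connected_graph (induced T U) \<longleftrightarrow> ?e U + 1 = k" if "U \<in> ?Us" for U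
  proof -
    have "U \<subseteq> ?V" "U \<noteq> {}" "card U = k" using that assms(2) by auto
    then show "?e U + 1 \<le> k" "connected_graph (induced T U) \<longleftrightarrow> ?e U + 1 = k"
      using forest_card_edges[OF fo, of U] finite_subset[OF _ fV] by auto
  qed
  show "real (card (split_cols T y z k)) = real z * poly R (real z)" if z: "z \<ge> 1" for z
  proof -
    have "real (card (cols T U {y<..y + z}) * card (cols T (?V - U) {1..y})) =
        real z * (?f U * (real z ^ (k - ?e U - 1) * (real z - 1) ^ ?e U))" if U: "U \<in> ?Us" for U
    proof -
      have "card (cols T U {y<..y + z}) = z ^ (k - ?e U) * (z - 1) ^ ?e U"
        using U finite_subset[OF _ fV] by (subst card_cols[OF fo]) auto
      moreover have "card (?V - U) = card ?V - k"
        using U finite_subset[OF _ fV] by (subst card_Diff_subset) auto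
      then have "card (cols T (?V - U) {1..y}) = y ^ (card ?V - k - ?e (?V - U)) * (y - 1) ^ ?e (?V - U)"
        using fV by (subst card_cols[OF fo]) auto
      moreover have "real z ^ (k - ?e U) = real z * real z ^ (k - ?e U - 1)"
        using le[OF U] by (cases "k - ?e U") auto
      ultimately show ?thesis using z assms(3) by (simp add: of_nat_diff mult_ac)
    qed
    then show ?thesis
      by (simp add: card_split_cols[OF sg] R_def poly_sum poly_monom sum_distrib_left)
  qed
  \<comment> \<open>At \<open>z = 0\<close> the remaining power of \<open>z\<close> vanishes unless
    its exponent is 0, that is, unless \<open>U\<close> has \<open>k - 1\<close> edges and so is
    connected.\<close>
  have term0: "?f U * (0 ^ (k - ?e U - 1) * (-1) ^ ?e U) = (if connected_graph (induced T U) then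
      (-1) ^ (k - 1) * (real y - 1) ^ (card ?V - k) * (real y / (real y - 1)) ^ card (boundary T U) else 0)"
    if U: "U \<in> ?Us" for U
  proof (cases "connected_graph (induced T U)")
    case True
    then have eU: "?e U = k - 1" "k - ?e U - 1 = 0" using conn[OF U] by auto
    have "card (edges T) = ?e U + ?e (?V - U) + card (boundary T U)"
      using card_edges_partition[OF sg, of U] U by simp
    \<comment> \<open>The tree has one edge less than vertices and \<open>k - 1\<close> of them lie
      in \<open>U\<close>; the others lie in the complement or leave \<open>U\<close>. This trades
      edges of the complement for leaving edges.\<close>
    then have b: "card (boundary T U) + ?e (?V - U) = card ?V - k"
      using tree_card_edges[OF assms(1)] eU assms(2) by linarith
    then have "?f U = real y ^ card (boundary T U) * (real y - 1) ^ (card ?V - k - card (boundary T U))"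
      by (metis add_diff_cancel_left' add_diff_cancel_right')
    also have "\<dots> = (real y - 1) ^ (card ?V - k) * (real y / (real y - 1)) ^ card (boundary T U)"
      unfolding b[symmetric] using assms(3) by (simp add: power_add power_divide)
    finally show ?thesis using True eU by simp
  next
    case False
    then have "k - ?e U - 1 > 0" using conn[OF U] le[OF U] by linarith
    then show ?thesis using False by simp
  qed
  have "poly R 0 = (\<Sum>U\<in>?Us. ?f U * (0 ^ (k - ?e U - 1) * (-1) ^ ?e U))"
    by (simp add: R_def poly_sum poly_monom)
  also have "\<dots> = (\<Sum>U\<in>?Us. if connected_graph (induced T U) then
      (-1) ^ (k - 1) * (real y - 1) ^ (card ?V - k) * (real y / (real y - 1)) ^ card (boundary T U) else 0)"
    using term0 by (intro sum.cong refl) blast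
  also have "\<dots> = (\<Sum>U | U \<in> conn_sets T \<and> card U = k.
      (-1) ^ (k - 1) * (real y - 1) ^ (card ?V - k) * (real y / (real y - 1)) ^ card (boundary T U))"
    using fV by (subst sum.inter_filter[symmetric]) (auto simp: conn_sets_def intro!: sum.cong)
  finally show "poly R 0 = (-1) ^ (k - 1) * (real y - 1) ^ (card (verts T) - k)
      * poly (boundary_poly T k) (real y / (real y - 1))"
    by (simp add: boundary_poly_def poly_sum poly_monom sum_distrib_left)
qed

lemma coeff_boundary_poly:
  assumes "finite (verts G)"
  shows "coeff (boundary_poly G k) d = card {U \<in> conn_sets G. card U = k \<and> card (boundary G U) = d}"
proof -
  have "finite {U \<in> conn_sets G. card U = k}" using assms by (simp add: conn_sets_def)
  then show ?thesis
    by (simp add: boundary_poly_def coeff_sum sum.If_cases Int_def conj_assoc)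
qed

text \<open>For fixed \<open>y\<close> the counts at all \<open>z \<ge> 1\<close> fix the polynomial
  \<open>R\<close>, hence its value at 0. This yields the value of \<open>boundary_poly\<close> at
  \<open>y / (y - 1)\<close>; varying \<open>y\<close> gives infinitely many points and so all
  coefficients.\<close>

lemma chromatic_symmetric_determines:
  fixes T1 :: "'a ugraph" and T2 :: "'b ugraph"
  assumes "is_tree T1" "is_tree T2" "chromatic_symmetric T1 = chromatic_symmetric T2"
  shows "card (verts T1) = card (verts T2)"
    and "k \<ge> 1 \<Longrightarrow> card {U \<in> conn_sets T1. card U = k \<and> card (boundary T1 U) = d} =
      card {U \<in> conn_sets T2. card U = k \<and> card (boundary T2 U) = d}"
proof -
  have sg: "simple_graph T1" "simple_graph T2" using assms by (auto simp: is_tree_def)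
  then have fV: "finite (verts T1)" "finite (verts T2)" by (auto simp: simple_graph_def)
  have "int (card (split_cols T1 y z k)) = int (card (split_cols T2 y z k))" for y z k
    by (simp add: card_split_cols_chromatic sg assms(3))
  then have K: "card (split_cols T1 y z k) = card (split_cols T2 y z k)" for y z k by simp
  have fK: "finite (split_cols T1 y z k)" "finite (split_cols T2 y z k)" for y z k
    using fV by (auto simp: split_cols_def finite_cols)
  show n: "card (verts T1) = card (verts T2)"
    using split_cols_all_special(1)[OF sg(1)] split_cols_all_special(2)[OF sg(2)] K fK
    by (metis card_eq_0_iff)
  assume k: "k \<ge> 1"
  have "boundary_poly T1 k = boundary_poly T2 k"
  proof (rule poly_eq_if_infinitely_many)
    have "inj_on (\<lambda>y. real y / (real y - 1)) {2..}"
      by (auto simp: inj_on_def field_simps)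
    then show "infinite ((\<lambda>y. real y / (real y - 1)) ` {2..})"
      using infinite_Ici[of "2::nat"] finite_imageD by blast
    fix x assume "x \<in> (\<lambda>y. real y / (real y - 1)) ` {2..}"
    then obtain y where y: "y \<ge> 2" and x: "x = real y / (real y - 1)" by auto
    obtain R1 where R1: "\<And>z. z \<ge> 1 \<Longrightarrow> real (card (split_cols T1 y z k)) = real z * poly R1 (real z)"
        "poly R1 0 = (-1) ^ (k - 1) * (real y - 1) ^ (card (verts T1) - k) * poly (boundary_poly T1 k) x"
      using split_cols_poly[OF assms(1) k y] unfolding x by metis
    obtain R2 where R2: "\<And>z. z \<ge> 1 \<Longrightarrow> real (card (split_cols T2 y z k)) = real z * poly R2 (real z)"
        "poly R2 0 = (-1) ^ (k - 1) * (real y - 1) ^ (card (verts T2) - k) * poly (boundary_poly T2 k) x"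
      using split_cols_poly[OF assms(2) k y] unfolding x by metis
    have "R1 = R2"
    proof (rule poly_eq_if_infinitely_many)
      show "infinite (real ` {1..})"
        using infinite_Ici[of "1::nat"] finite_imageD inj_on_of_nat by blast
      show "poly R1 a = poly R2 a" if "a \<in> real ` {1..}" for a
        using that R1(1) R2(1) K by fastforce
    qed
    then show "poly (boundary_poly T1 k) x = poly (boundary_poly T2 k) x"
      using R1(2) R2(2) n y by simp
  qed
  then have "real (card {U \<in> conn_sets T1. card U = k \<and> card (boundary T1 U) = d}) =
      real (card {U \<in> conn_sets T2. card U = k \<and> card (boundary T2 U) = d})"
    using coeff_boundary_poly[OF fV(1), of k d] coeff_boundary_poly[OF fV(2), of k d] by simp
  then show "card {U \<in> conn_sets T1. card U = k \<and> card (boundary T1 U) = d} =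
      card {U \<in> conn_sets T2. card U = k \<and> card (boundary T2 U) = d}" by simp
qed

subsection \<open>Degree counts and chains\<close>

definition branches :: "'a ugraph \<Rightarrow> 'a set" where
  "branches G = {v \<in> verts G. degree_of G v \<ge> 3}"

locale tree_graph =
  fixes T :: "'a ugraph"
  assumes tree: "is_tree T"
begin

lemma simple_T: "simple_graph T" and forest_T: "forest T" and finite_verts: "finite (verts T)"
  using tree by (auto simp: is_tree_def tree_forest simple_graph_def)

lemma degree_eq: "degree_of T v = card (nbrs T v)"
  by (rule degree_of_eq_card_nbrs[OF simple_T])

lemma finite_nbrs_T: "finite (nbrs T v)"
  by (rule finite_nbrs[OF simple_T])

lemma verts_conn_sets: "verts T \<in> conn_sets T"
  using tree by (simp add: conn_sets_def induced_verts simple_T is_tree_def)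

lemma conn_setsD:
  assumes "U \<in> conn_sets T"
  shows "U \<subseteq> verts T" "U \<noteq> {}" "finite U" "card (edges_in T U) + 1 = card U"
  using assms forest_card_edges[OF forest_T, of U] finite_subset[OF _ finite_verts, of U]
  by (auto simp: conn_sets_def connected_graph_def)

lemma conn_sets_cut:
  assumes "U \<in> conn_sets T" "A \<noteq> {}" "A \<subset> U"
  obtains a b where "a \<in> A" "b \<in> U - A" "b \<in> nbrs T a"
  using assms unfolding conn_sets_def connected_induced_iff_cut by blast

lemma tree_induced:
  assumes "U \<in> conn_sets T" shows "is_tree (induced T U)"
  using assms forest_induced[OF forest_T] by (auto simp: conn_sets_def is_tree_def forest_def)

lemma degree_pos:
  assumes "card (verts T) \<ge> 2" "v \<in> verts T" shows "degree_of T v \<ge> 1"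
proof -
  have "verts T \<noteq> {v}" using assms(1) by auto
  then have "{v} \<subset> verts T" using assms(2) by blast
  then obtain b where "b \<in> nbrs T v" using conn_sets_cut[OF verts_conn_sets, of "{v}"] by blast
  then have "card (nbrs T v) \<noteq> 0" using finite_nbrs_T card_eq_0_iff by auto
  then show ?thesis unfolding degree_eq by linarith
qed

text \<open>Truncated subtraction restricts the sum to the vertices of degree at least 3.\<close>

lemma card_boundary:
  assumes "card (verts T) \<ge> 2" "U \<in> conn_sets T"
  shows "card (boundary T U) + card (U \<inter> leaves T) = 2 + (\<Sum>v\<in>U. degree_of T v - 2)"
proof -
  note U = conn_setsD[OF assms(2)]
  have "(\<Sum>v\<in>U. degree_of T v + (if v \<in> leaves T then 1 else 0)) = (\<Sum>v\<in>U. 2 + (degree_of T v - 2))"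
  proof (rule sum.cong[OF refl])
    fix v assume "v \<in> U"
    then have "v \<in> verts T" using U(1) by blast
    then show "degree_of T v + (if v \<in> leaves T then 1 else 0) = 2 + (degree_of T v - 2)"
      using degree_pos[OF assms(1), of v] by (auto simp: leaves_def)
  qed
  also have "\<dots> = 2 * card U + (\<Sum>v\<in>U. degree_of T v - 2)"
    by (simp only: sum.distrib sum_constant mult.commute[of 2] of_nat_id)
  also have "(\<Sum>v\<in>U. degree_of T v + (if v \<in> leaves T then 1 else 0)) =
      (\<Sum>v\<in>U. degree_of T v) + card (U \<inter> leaves T)"
    using U(3) by (simp add: sum.distrib sum.If_cases)
  also have "(\<Sum>v\<in>U. degree_of T v) = 2 * card (edges_in T U) + card (boundary T U)"
    using sum_card_nbrs[OF simple_T U(1)] by (simp add: degree_eq boundary_def)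
  finally show ?thesis using U(4) by linarith
qed

lemma card_leaves:
  assumes "card (verts T) \<ge> 2"
  shows "card (leaves T) = 2 + (\<Sum>v\<in>verts T. degree_of T v - 2)"
proof -
  have "card (e \<inter> verts T) = 2" if "e \<in> edges T" for e
    using simple_T that by (auto simp: simple_graph_def Int_absorb2)
  then have "boundary T (verts T) = {}" by (auto simp: boundary_def)
  moreover have "verts T \<inter> leaves T = leaves T" by (auto simp: leaves_def)
  ultimately show ?thesis using card_boundary[OF assms verts_conn_sets] by simp
qed

text \<open>Both invariants determine the number of leaves, so this lets them recognize
  paths.\<close>

lemma branches_empty_iff:
  assumes "card (verts T) \<ge> 2" shows "branches T = {} \<longleftrightarrow> card (leaves T) = 2"
  using card_leaves[OF assms] finite_verts by (auto simp: branches_def)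

lemma sum_excess:
  assumes "U \<subseteq> verts T"
  shows "(\<Sum>v\<in>verts T. degree_of T v - 2) = (\<Sum>v\<in>U. degree_of T v - 2) + (\<Sum>v\<in>verts T - U. degree_of T v - 2)"
  using sum.subset_diff[OF assms finite_verts, of "\<lambda>v. degree_of T v - 2"] by simp

text \<open>The number of leaves of the tree exceeds the number of edges leaving \<open>U\<close> by
  the excess degree outside \<open>U\<close> plus the number of leaves in \<open>U\<close>. Both
  terms are nonnegative, so equality means that both vanish.\<close>

lemma boundary_maximal_iff:
  assumes "card (verts T) \<ge> 2" "U \<in> conn_sets T"
  shows "card (boundary T U) = card (leaves T) \<longleftrightarrow> branches T \<subseteq> U \<and> U \<inter> leaves T = {}"
proof -
  note U = conn_setsD[OF assms(2)]
  have "card (boundary T U) = card (leaves T) \<longleftrightarrow>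
      (\<Sum>v\<in>verts T - U. degree_of T v - 2) + card (U \<inter> leaves T) = 0"
    using card_boundary[OF assms] card_leaves[OF assms(1)] sum_excess[OF U(1)] by linarith
  also have "\<dots> \<longleftrightarrow> branches T \<subseteq> U \<and> U \<inter> leaves T = {}"
    using finite_verts U(3) by (auto simp: branches_def subset_iff) force
  finally show ?thesis .
qed

text \<open>The leaf formula holds for \<open>U\<close> and \<open>T\<close> alike, and the excess
  degree of a vertex within \<open>U\<close> is at most that in \<open>T\<close>. Equal sums force
  equality at each vertex, so every branch vertex must lie in \<open>U\<close> with all its
  neighbors.\<close>

lemma card_leaves_induced:
  assumes "U \<in> conn_sets T" "card U \<ge> 2"
  shows "card (leaves (induced T U)) \<le> card (leaves T)"
    and "card (leaves (induced T U)) = card (leaves T) \<longleftrightarrow>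
      branches T \<subseteq> U \<and> (\<forall>v\<in>branches T. nbrs T v \<subseteq> U)"
proof -
  note U = conn_setsD[OF assms(1)]
  interpret S: tree_graph "induced T U" by unfold_locales (rule tree_induced[OF assms(1)])
  have n: "card (verts T) \<ge> 2" using assms(2) card_mono[OF finite_verts U(1)] by linarith
  let ?d = "\<lambda>v. if v \<in> U then card (nbrs T v \<inter> U) - 2 else 0"
  have "card (leaves (induced T U)) = 2 + (\<Sum>v\<in>U. card (nbrs T v \<inter> U) - 2)"
    using S.card_leaves assms(2) by (simp add: S.degree_eq nbrs_induced)
  also have "(\<Sum>v\<in>U. card (nbrs T v \<inter> U) - 2) = (\<Sum>v\<in>verts T. ?d v)"
    using finite_verts U(1) by (simp add: sum.If_cases Int_absorb1)
  finally have lS: "card (leaves (induced T U)) = 2 + (\<Sum>v\<in>verts T. ?d v)" .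
  have le: "?d v \<le> degree_of T v - 2" for v
    using card_mono[OF finite_nbrs_T, of "nbrs T v \<inter> U" v] by (auto simp: degree_eq diff_le_mono)
  show "card (leaves (induced T U)) \<le> card (leaves T)"
    unfolding lS card_leaves[OF n] using le by (intro add_left_mono sum_mono)
  have "card (leaves (induced T U)) = card (leaves T) \<longleftrightarrow> (\<forall>v\<in>verts T. ?d v = degree_of T v - 2)"
    unfolding lS card_leaves[OF n] add_left_cancel
  proof
    assume "(\<Sum>v\<in>verts T. ?d v) = (\<Sum>v\<in>verts T. degree_of T v - 2)"
    from sum_mono_inv[OF this] show "\<forall>v\<in>verts T. ?d v = degree_of T v - 2" using le finite_verts by blast
  qed (rule sum.cong, auto)
  also have "\<dots> \<longleftrightarrow> branches T \<subseteq> U \<and> (\<forall>v\<in>branches T. nbrs T v \<subseteq> U)"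
  proof
    assume eq: "\<forall>v\<in>verts T. ?d v = degree_of T v - 2"
    have "v \<in> U \<and> nbrs T v \<subseteq> U" if "v \<in> branches T" for v
    proof -
      have v: "v \<in> verts T" "degree_of T v \<ge> 3" using that by (auto simp: branches_def)
      then have "v \<in> U" "card (nbrs T v \<inter> U) = card (nbrs T v)"
        using bspec[OF eq, of v] by (auto simp: degree_eq split: if_splits)
      then show ?thesis using card_subset_eq[OF finite_nbrs_T, of "nbrs T v \<inter> U" v] by blast
    qed
    then show "branches T \<subseteq> U \<and> (\<forall>v\<in>branches T. nbrs T v \<subseteq> U)" by blast
  next
    assume b: "branches T \<subseteq> U \<and> (\<forall>v\<in>branches T. nbrs T v \<subseteq> U)"
    show "\<forall>v\<in>verts T. ?d v = degree_of T v - 2"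
    proof
      fix v assume v: "v \<in> verts T"
      show "?d v = degree_of T v - 2"
      proof (cases "v \<in> branches T")
        case True
        then show ?thesis using b by (auto simp: degree_eq Int_absorb2)
      next
        case False
        then have "degree_of T v - 2 = 0" using v by (auto simp: branches_def)
        then show ?thesis using le[of v] by linarith
      qed
    qed
  qed
  finally show "card (leaves (induced T U)) = card (leaves T) \<longleftrightarrow>
      branches T \<subseteq> U \<and> (\<forall>v\<in>branches T. nbrs T v \<subseteq> U)" .
qed

text \<open>The edges leaving a single vertex are the edges at it. This puts the number of leaves
  among the counts that the chromatic symmetric function determines.\<close>

lemma card_leaves_eq_boundary:
  "card (leaves T) = card {U \<in> conn_sets T. card U = 1 \<and> card (boundary T U) = 1}"
proof -
  have "card (boundary T {v}) = degree_of T v" for v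
    unfolding boundary_def degree_of_def by (intro arg_cong[of _ _ card]) (auto simp: Int_insert_right)
  moreover have "connected_graph (induced T {v})" for v
    unfolding connected_induced_iff_cut by auto
  ultimately have "U \<in> conn_sets T \<and> card U = 1 \<and> card (boundary T U) = 1 \<longleftrightarrow> (\<exists>v\<in>leaves T. U = {v})" for U
    by (cases "\<exists>v. U = {v}") (auto simp: conn_sets_def leaves_def card_1_singleton_iff[of U])
  then have "{U \<in> conn_sets T. card U = 1 \<and> card (boundary T U) = 1} = (\<lambda>v. {v}) ` leaves T"
    by blast
  then show ?thesis by (simp add: card_image)
qed

section \<open>Chains: paths that leave a leaf through vertices of degree 2\<close>

definition is_chain :: "'a \<Rightarrow> 'a list \<Rightarrow> bool" where
  "is_chain l vs \<longleftrightarrow> is_path T vs \<and> hd vs = l \<and> (\<forall>v\<in>interior_verts vs. degree_of T v = 2)"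

lemma interior_verts_nth:
  "interior_verts vs = {vs ! i | i. 0 < i \<and> Suc i < length vs}"
proof -
  have "interior_verts vs = (\<lambda>j. butlast (tl vs) ! j) ` {..<length vs - 2}"
    by (auto simp: interior_verts_def set_conv_nth numeral_2_eq_2)
  also have "\<dots> = (\<lambda>j. vs ! Suc j) ` {..<length vs - 2}"
    by (intro image_cong) (auto simp: nth_butlast nth_tl)
  also have "{..<length vs - 2} = {j. Suc (Suc j) < length vs}" by auto
  also have "(\<lambda>j. vs ! Suc j) ` \<dots> = {vs ! i | i. 0 < i \<and> Suc i < length vs}"
    by (auto simp: image_def gr0_conv_Suc)
  finally show ?thesis .
qed

lemma is_path_nth:
  assumes "is_path T vs" "Suc i < length vs"
  shows "vs ! Suc i \<in> nbrs T (vs ! i)" "vs ! i \<in> nbrs T (vs ! Suc i)"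
  using assms by (auto simp: is_path_def successively_conv_nth nbrs_def insert_commute)

text \<open>Before its end a chain contains all neighbors of its vertices: the leaf has degree 1 and
  interior vertices degree 2. So its course is forced and it cannot be entered from outside before
  its end.\<close>

lemma chain_nbrs:
  assumes "l \<in> leaves T" "is_chain l vs" "Suc i < length vs"
  shows "nbrs T (vs ! i) = (if i = 0 then {vs ! 1} else {vs ! (i - 1), vs ! Suc i})"
proof -
  have p: "is_path T vs" and d: "distinct vs" using assms(2) by (auto simp: is_chain_def is_path_def)
  show ?thesis
  proof (cases "i = 0")
    case True
    have "vs ! 0 = l" using assms(2,3) by (cases vs) (auto simp: is_chain_def)
    then have "card (nbrs T (vs ! 0)) = 1" using assms(1) by (simp add: leaves_def degree_eq)
    then show ?thesis using is_path_nth(1)[OF p assms(3)] True by (auto simp: card_1_singleton_iff)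
  next
    case False
    then have "vs ! i \<in> interior_verts vs" using assms(3) by (auto simp: interior_verts_nth)
    then have c: "card (nbrs T (vs ! i)) = 2" using assms(2) by (auto simp: is_chain_def degree_eq)
    have "{vs ! (i - 1), vs ! Suc i} \<subseteq> nbrs T (vs ! i)"
      using is_path_nth(1)[OF p assms(3)] is_path_nth(2)[OF p, of "i - 1"] False assms(3) by auto
    moreover have "card {vs ! (i - 1), vs ! Suc i} = 2"
      using d False assms(3) by (auto simp: card_insert_if nth_eq_iff_index_eq)
    ultimately have "{vs ! (i - 1), vs ! Suc i} = nbrs T (vs ! i)"
      using c by (intro card_subset_eq finite_nbrs_T) auto
    then show ?thesis using False by simp
  qed
qed

text \<open>An end of degree 2 has a second neighbor \<open>x\<close>. It is new: by
  \<open>chain_nbrs\<close> the only earlier vertex adjacent to the end is the one just before it,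
  which the choice of \<open>x\<close> excludes.\<close>

lemma chain_extend:
  assumes l: "l \<in> leaves T" and c: "is_chain l vs" and d: "degree_of T (last vs) = 2"
  obtains x where "is_chain l (vs @ [x])"
proof -
  have p: "is_path T vs" and dist: "distinct vs" and len: "length vs \<ge> 2" and h: "hd vs = l"
    using c by (auto simp: is_chain_def is_path_def)
  let ?a = "length vs - 1"
  have last: "last vs = vs ! ?a" using len by (subst last_conv_nth) auto
  have "nbrs T (last vs) \<noteq> {vs ! (?a - 1)}" using d by (auto simp: degree_eq)
  moreover have "vs ! (?a - 1) \<in> nbrs T (last vs)"
    using is_path_nth(2)[OF p, of "?a - 1"] len by (simp add: last Suc_diff_Suc numeral_2_eq_2)
  ultimately obtain x where x: "x \<in> nbrs T (last vs)" "x \<noteq> vs ! (?a - 1)" by blast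
  note xv = nbrs_verts[OF simple_T x(1)]
  have "x \<notin> set vs"
  proof
    assume "x \<in> set vs"
    then obtain j where j: "j < length vs" "x = vs ! j" by (auto simp: in_set_conv_nth)
    then have "j \<noteq> ?a" and j2: "j \<noteq> ?a - 1" using xv x(2) last by auto
    then have j': "Suc j < length vs" using j(1) by linarith
    have "vs ! ?a \<in> nbrs T (vs ! j)" using x(1) j(2) nbrs_sym[of x T] by (simp add: last)
    then have "vs ! ?a = vs ! (j - 1) \<or> vs ! ?a = vs ! Suc j"
      using chain_nbrs[OF l c j'] by (auto split: if_splits)
    then have "?a = j - 1 \<or> ?a = Suc j"
      using dist j' by (auto simp: nth_eq_iff_index_eq)
    then show False using j' j2 by linarith
  qed
  then have "is_path T (vs @ [x])"
    using p xv x(1) len by (auto simp: is_path_def successively_append_iff nbrs_def)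
  moreover have "interior_verts (vs @ [x]) = insert (last vs) (interior_verts vs)"
    using len by (cases vs rule: rev_cases) (auto simp: interior_verts_def butlast_append tl_append split: list.splits)
  ultimately have "is_chain l (vs @ [x])"
    using c d len by (cases vs) (auto simp: is_chain_def)
  then show thesis by (rule that)
qed

lemma ex_chain:
  assumes l: "l \<in> leaves T"
  shows "\<exists>vs. is_chain l vs \<and> degree_of T (last vs) \<noteq> 2"
proof -
  obtain w where w: "w \<in> nbrs T l" using l by (force simp: leaves_def degree_eq card_1_singleton_iff)
  then have "is_path T [l, w]" using nbrs_verts[OF simple_T w] by (auto simp: is_path_def nbrs_def)
  then have "is_chain l [l, w]" by (simp add: is_chain_def interior_verts_def)
  then obtain vs where vs: "is_chain l vs" and max: "\<And>ys. is_chain l ys \<Longrightarrow> length ys \<le> length vs"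
    using ex_has_greatest_nat[of "is_chain l" _ length "Suc (card (verts T))"] length_path_le[OF simple_T]
    by (metis le_imp_less_Suc is_chain_def)
  have "degree_of T (last vs) \<noteq> 2"
    using chain_extend[OF l vs] max by (metis length_append_singleton not_less_eq_eq order_refl)
  then show ?thesis using vs by blast
qed

text \<open>For a leaf \<open>l\<close> the choice is unique: by \<open>chain_prefix\<close> all
  chains from \<open>l\<close> are prefixes of \<open>chain l\<close>, and a proper prefix ends in
  an interior vertex of it, which has degree 2.\<close>

definition chain :: "'a \<Rightarrow> 'a list" where
  "chain l = (SOME vs. is_chain l vs \<and> degree_of T (last vs) \<noteq> 2)"

definition arm_length :: "'a \<Rightarrow> nat" where
  "arm_length l = length (chain l) - 1"

context
  fixes l assumes l: "l \<in> leaves T"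
begin

lemma is_chain_chain: "is_chain l (chain l)" and degree_last: "degree_of T (last (chain l)) \<noteq> 2"
  using someI_ex[OF ex_chain[OF l]] by (auto simp: chain_def)

lemma length_chain: "length (chain l) = Suc (arm_length l)" and arm_length_pos: "arm_length l \<ge> 1"
  using is_chain_chain by (auto simp: arm_length_def is_chain_def is_path_def)

lemma distinct_chain: "distinct (chain l)" and path_chain: "is_path T (chain l)"
  and chain_verts: "i \<le> arm_length l \<Longrightarrow> chain l ! i \<in> verts T"
  using is_chain_chain length_chain nth_mem[of i "chain l"] by (auto simp: is_chain_def is_path_def)

lemma last_chain: "last (chain l) = chain l ! arm_length l"
  using length_chain by (subst last_conv_nth) auto

lemma chain_0: "chain l ! 0 = l"
  using is_chain_chain length_chain by (cases "chain l") (auto simp: is_chain_def)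

lemma nbrs_chain:
  "i < arm_length l \<Longrightarrow> nbrs T (chain l ! i) =
    (if i = 0 then {chain l ! 1} else {chain l ! (i - 1), chain l ! Suc i})"
  using chain_nbrs[OF l is_chain_chain] length_chain by simp

lemma degree_chain: "0 < i \<Longrightarrow> i < arm_length l \<Longrightarrow> degree_of T (chain l ! i) = 2"
  using is_chain_chain length_chain by (auto simp: is_chain_def interior_verts_nth)

text \<open>Two chains that agree so far have the same neighbors at the current vertex and the same
  predecessor, hence the same successor.\<close>

lemma chain_prefix:
  assumes "is_chain l ys" "i < length ys"
  shows "i < length (chain l) \<and> ys ! i = chain l ! i"
  using assms(2)
proof (induction i rule: less_induct)
  case (less i)
  show ?case
  proof (cases i)
    case 0
    then show ?thesis using assms less.prems chain_0 length_chain by (cases ys) (auto simp: is_chain_def)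
  next
    case (Suc j)
    then have IH: "j < length (chain l)" "ys ! j = chain l ! j" using less by auto
    \<comment> \<open>\<open>chain l\<close> cannot stop first: its end does not have degree 2, but
      would be an interior vertex of \<open>ys\<close>.\<close>
    have "j \<noteq> arm_length l"
    proof
      assume a: "j = arm_length l"
      then have "ys ! j \<in> interior_verts ys"
        using arm_length_pos less.prems Suc by (auto simp: interior_verts_nth)
      then show False using assms(1) a IH degree_last by (auto simp: is_chain_def last_chain)
    qed
    then have j: "j < arm_length l" using IH length_chain by simp
    have "(if j = 0 then {ys ! 1} else {ys ! (j - 1), ys ! Suc j}) =
        (if j = 0 then {chain l ! 1} else {chain l ! (j - 1), chain l ! Suc j})"
      using nbrs_chain[OF j] chain_nbrs[OF l assms(1)] less.prems Suc IH(2) by metis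
    moreover have "j > 0 \<Longrightarrow> ys ! (j - 1) = chain l ! (j - 1)" using less Suc by simp
    ultimately show ?thesis using Suc j length_chain
      by (auto simp: doubleton_eq_iff split: if_splits)
  qed
qed

end

end

subsection \<open>Twigs and trunk\<close>

lemma interior_verts_rev: "interior_verts (rev vs) = interior_verts vs"
proof -
  have "butlast (tl (rev vs)) = rev (butlast (tl vs))"
    by (metis butlast_rev butlast_tl rev_rev_ident)
  then show ?thesis by (simp add: interior_verts_def)
qed

lemma is_path_rev: "is_path G (rev vs) \<longleftrightarrow> is_path G vs"
  by (simp add: is_path_def successively_rev insert_commute)

lemma path_graph_rev: "path_graph (rev vs) = path_graph vs"
proof -
  have sub: "{{rev vs ! i, rev vs ! Suc i} | i. Suc i < length vs} \<subseteq> {{vs ! i, vs ! Suc i} | i. Suc i < length vs}"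
    for vs :: "'a list"
  proof safe
    fix i assume i: "Suc i < length vs"
    let ?j = "length vs - Suc (Suc i)"
    have "rev vs ! i = vs ! Suc ?j" "rev vs ! Suc i = vs ! ?j" "Suc ?j < length vs"
      using i by (auto simp: rev_nth Suc_diff_Suc)
    then show "\<exists>j. {rev vs ! i, rev vs ! Suc i} = {vs ! j, vs ! Suc j} \<and> Suc j < length vs"
      by (metis insert_commute)
  qed
  show ?thesis using sub[of vs] sub[of "rev vs"] by (auto simp: path_graph_def)
qed

lemma card_edges_path_graph:
  assumes "distinct vs" shows "card (edges (path_graph vs)) = length vs - 1"
proof -
  have "edges (path_graph vs) = (\<lambda>i. {vs ! i, vs ! Suc i}) ` {i. Suc i < length vs}"
    by (auto simp: path_graph_def)
  moreover have "inj_on (\<lambda>i. {vs ! i, vs ! Suc i}) {i. Suc i < length vs}"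
    using assms by (auto simp: inj_on_def doubleton_eq_iff nth_eq_iff_index_eq)
  moreover have "{i. Suc i < length vs} = {..<length vs - 1}" by auto
  ultimately show ?thesis by (simp add: card_image)
qed

context tree_graph
begin

text \<open>A leaf has degree 1 and is not interior to a candidate path, so that path or its
  reversal is a chain from \<open>l\<close>, a prefix of \<open>chain l\<close>. Hence the longest
  candidate is \<open>chain l\<close> up to reversal, which \<open>path_graph\<close>
  forgets.\<close>

lemma twig_of_leaf:
  assumes l: "l \<in> leaves T"
  shows "is_twig_of T l (chain l)"
    and "is_twig_of T l vs \<Longrightarrow> path_graph vs = path_graph (chain l)"
proof -
  let ?P = "\<lambda>vs. is_path T vs \<and> l \<in> set vs \<and> (\<forall>v\<in>interior_verts vs. degree_of T v = 2)"
  have P: "is_chain l vs \<or> is_chain l (rev vs)" if "?P vs" for vs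
  proof -
    have "l \<notin> interior_verts vs" using that l by (auto simp: leaves_def)
    moreover have "vs = hd vs # butlast (tl vs) @ [last vs]"
      using that by (cases vs; cases "tl vs" rule: rev_cases) (auto simp: is_path_def)
    then have "set vs = {hd vs, last vs} \<union> interior_verts vs"
      unfolding interior_verts_def by (metis Un_commute insert_is_Un list.simps(15) set_append list.set(1) Un_assoc)
    ultimately have "hd vs = l \<or> last vs = l" using that by auto
    then show ?thesis using that by (auto simp: is_chain_def is_path_rev interior_verts_rev hd_rev)
  qed
  have le: "length vs \<le> length (chain l)" if "is_chain l vs" for vs
    using chain_prefix[OF l that, of "length vs - 1"] by (cases vs) auto
  have "?P (chain l)" using is_chain_chain[OF l] chain_0[OF l] length_chain[OF l]
    by (auto simp: is_chain_def in_set_conv_nth)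
  moreover have "length vs \<le> length (chain l)" if "?P vs" for vs
    using P[OF that] le by fastforce
  ultimately show "is_twig_of T l (chain l)"
    by (auto simp: is_twig_of_def is_arg_max_def not_less)
  have eq: "vs = chain l" if "is_chain l vs" "length (chain l) \<le> length vs" for vs
    using le[OF that(1)] that(2) chain_prefix[OF l that(1)] by (intro nth_equalityI) auto
  assume "is_twig_of T l vs"
  then have "?P vs" "length (chain l) \<le> length vs"
    using \<open>?P (chain l)\<close> by (auto simp: is_twig_of_def is_arg_max_def not_less)
  then have "vs = chain l \<or> rev vs = chain l" using P[of vs] eq[of vs] eq[of "rev vs"] by auto
  then show "path_graph vs = path_graph (chain l)" by (metis path_graph_rev)
qed

lemma twigs_eq: "twigs T = (\<lambda>l. path_graph (chain l)) ` leaves T"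
proof (intro equalityI subsetI)
  fix P assume "P \<in> twigs T"
  then obtain l vs where "P = path_graph vs" "l \<in> leaves T" "is_twig_of T l vs"
    by (auto simp: twigs_def)
  then show "P \<in> (\<lambda>l. path_graph (chain l)) ` leaves T" using twig_of_leaf(2) by blast
next
  fix P assume "P \<in> (\<lambda>l. path_graph (chain l)) ` leaves T"
  then show "P \<in> twigs T" using twig_of_leaf(1) by (auto simp only: twigs_def)
qed

lemma finite_leaves: "finite (leaves T)"
  using finite_verts by (simp add: leaves_def)

lemma finite_twigs: "finite (twigs T)"
  using finite_leaves by (simp add: twigs_eq)

lemma card_edges_twig:
  "l \<in> leaves T \<Longrightarrow> card (edges (path_graph (chain l))) = arm_length l"
  by (simp add: card_edges_path_graph distinct_chain length_chain)

text \<open>A chain ending in a vertex of degree 1 contains all neighbors of its vertices, so by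
  connectedness nothing lies outside it.\<close>

lemma chain_covers:
  assumes l: "l \<in> leaves T" and d: "degree_of T (last (chain l)) = 1"
  shows "set (chain l) = verts T"
proof (rule ccontr)
  assume "set (chain l) \<noteq> verts T"
  moreover have "set (chain l) \<subseteq> verts T" "set (chain l) \<noteq> {}"
    using path_chain[OF l] by (auto simp: is_path_def)
  ultimately obtain a b where ab: "a \<in> set (chain l)" "b \<notin> set (chain l)" "b \<in> nbrs T a"
    using conn_sets_cut[OF verts_conn_sets, of "set (chain l)"] by blast
  obtain i where i: "i \<le> arm_length l" "a = chain l ! i"
    using ab(1) length_chain[OF l] by (auto simp: in_set_conv_nth less_Suc_eq_le)
  have mem: "chain l ! j \<in> set (chain l)" if "j \<le> arm_length l" for j
    using that length_chain[OF l] by simp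
  have "nbrs T a \<subseteq> set (chain l)"
  proof (cases "i = arm_length l")
    case True
    have "chain l ! (i - 1) \<in> nbrs T a"
      using is_path_nth(2)[OF path_chain[OF l], of "i - 1"] arm_length_pos[OF l] length_chain[OF l] i True
      by simp
    moreover have "card (nbrs T a) = 1" using d True i by (simp add: last_chain[OF l] degree_eq)
    ultimately show ?thesis using mem[of "i - 1"] i by (auto simp: card_1_singleton_iff)
  next
    case False
    then show ?thesis using nbrs_chain[OF l, of i] i mem arm_length_pos[OF l] by auto
  qed
  then show False using ab by blast
qed

text \<open>The end does not have degree 2. With degree 1 the chain would cover the tree by
  \<open>chain_covers\<close>, leaving no room for a branch vertex.\<close>

lemma last_chain_branch:
  assumes l: "l \<in> leaves T" and b: "branches T \<noteq> {}"
  shows "chain l ! arm_length l \<in> branches T"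
proof (rule ccontr)
  assume nb: "chain l ! arm_length l \<notin> branches T"
  have v: "chain l ! arm_length l \<in> verts T" by (simp add: chain_verts[OF l])
  have n: "card (verts T) \<ge> 2"
    using length_path_le[OF simple_T path_chain[OF l]] length_chain[OF l] arm_length_pos[OF l] by linarith
  have d: "degree_of T (last (chain l)) = 1"
    using nb v degree_pos[OF n v] degree_last[OF l] by (simp add: last_chain[OF l] branches_def)
  obtain x where x: "x \<in> branches T" using b by blast
  then have "x \<in> set (chain l)" using chain_covers[OF l d] by (auto simp: branches_def)
  then obtain i where i: "i \<le> arm_length l" "x = chain l ! i"
    using length_chain[OF l] by (auto simp: in_set_conv_nth less_Suc_eq_le)
  have "i \<noteq> 0" using x i l chain_0[OF l] by (cases i) (auto simp: branches_def leaves_def)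
  moreover have "i \<noteq> arm_length l" using x i nb by auto
  ultimately have "degree_of T x = 2" using degree_chain[OF l, of i] i by simp
  then show False using x by (simp add: branches_def)
qed

text \<open>The chain from either end covers the tree, and comparing numbers of edges makes its path
  graph all of \<open>T\<close>. So both leaves have the same twig.\<close>

lemma twig_lengths_path:
  assumes n: "card (verts T) \<ge> 2" and b: "branches T = {}"
  shows "twig_lengths T = {#card (edges T)#}"
proof -
  have T: "path_graph (chain l) = T" if l: "l \<in> leaves T" for l
  proof -
    have v: "last (chain l) \<in> verts T" by (simp add: chain_verts[OF l] last_chain[OF l])
    have "degree_of T (last (chain l)) = 1"
      using degree_pos[OF n v] degree_last[OF l] b v by (auto simp: branches_def not_le[symmetric])
    then have V: "set (chain l) = verts T" by (rule chain_covers[OF l])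
    then have "length (chain l) = card (verts T)" using distinct_chain[OF l] distinct_card by metis
    then have "card (edges (path_graph (chain l))) = card (edges T)"
      using tree_card_edges[OF tree] length_chain[OF l] by (simp add: card_edges_twig[OF l])
    moreover have "edges (path_graph (chain l)) \<subseteq> edges T"
      using is_path_nth(1)[OF path_chain[OF l]] by (auto simp: path_graph_def nbrs_def)
    ultimately have "edges (path_graph (chain l)) = edges T"
      using finite_edges[OF simple_T] by (simp add: card_subset_eq)
    then show ?thesis using V by (simp add: path_graph_def)
  qed
  have "leaves T \<noteq> {}" using b branches_empty_iff[OF n] by auto
  then have "twigs T = {T}" using T by (auto simp: twigs_eq)
  then show ?thesis by (simp add: twig_lengths_def)
qed

text \<open>Distinct leaves have distinct twigs: apart from \<open>l\<close>, the chain from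
  \<open>l\<close> has only vertices of degree 2 and a branch vertex at its end, hence no second
  leaf.\<close>

lemma twig_lengths_branched:
  assumes b: "branches T \<noteq> {}"
  shows "twig_lengths T = image_mset arm_length (mset_set (leaves T))"
proof -
  have "inj_on (\<lambda>l. path_graph (chain l)) (leaves T)"
  proof (rule inj_onI, rule ccontr)
    fix l l' assume l: "l \<in> leaves T" "l' \<in> leaves T" and ne: "l \<noteq> l'"
      and eq: "path_graph (chain l) = path_graph (chain l')"
    have "set (chain l) = set (chain l')" using eq by (simp add: path_graph_def)
    moreover have "l' \<in> set (chain l')" using chain_0[OF l(2)] length_chain[OF l(2)]
      by (metis nth_mem zero_less_Suc)
    ultimately have "l' \<in> set (chain l)" by simp
    then obtain i where i: "i \<le> arm_length l" "l' = chain l ! i"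
      using length_chain[OF l(1)] by (auto simp: in_set_conv_nth less_Suc_eq_le)
    have "i \<noteq> 0" using i ne chain_0[OF l(1)] by metis
    moreover have "degree_of T l' = 1" using l by (simp add: leaves_def)
    moreover have "i \<noteq> arm_length l"
      using last_chain_branch[OF l(1) b] i \<open>degree_of T l' = 1\<close> by (auto simp: branches_def)
    ultimately show False using degree_chain[OF l(1), of i] i by simp
  qed
  then have "mset_set (twigs T) = image_mset (\<lambda>l. path_graph (chain l)) (mset_set (leaves T))"
    unfolding twigs_eq by (rule image_mset_mset_set[symmetric])
  then show ?thesis
    using card_edges_twig finite_leaves
    by (auto simp: twig_lengths_def multiset.map_comp intro!: image_mset_cong)
qed

section \<open>Arms, the core, and trimmed sets\<close>

definition arm :: "'a \<Rightarrow> 'a set" where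
  "arm l = (\<lambda>i. chain l ! i) ` {..<arm_length l}"

text \<open>An arm omits the end of its chain. If there are branch vertices, that end is one of
  them, and what is left after deleting all arms is the trunk, see
  \<open>verts_trunk\<close>.\<close>

definition core :: "'a set" where
  "core = verts T - (\<Union>l\<in>leaves T. arm l)"

lemma inj_chain: "l \<in> leaves T \<Longrightarrow> inj_on (\<lambda>i. chain l ! i) {..arm_length l}"
  using distinct_chain length_chain by (auto simp: inj_on_def nth_eq_iff_index_eq)

lemma degree_arm: "l \<in> leaves T \<Longrightarrow> i < arm_length l \<Longrightarrow> degree_of T (chain l ! i) = (if i = 0 then 1 else 2)"
  using degree_chain chain_0 by (auto simp: leaves_def)

lemma arm_branches: "l \<in> leaves T \<Longrightarrow> arm l \<inter> branches T = {}"
  by (auto simp: arm_def branches_def degree_arm split: if_splits)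

text \<open>Trace a common vertex back along \<open>chain l\<close> to its leaf: each predecessor is
  again on the arm of \<open>l'\<close>, being adjacent to a vertex of it and not a branch vertex.
  On both arms degree 1 occurs only at index 0, so at the leaf \<open>l = l'\<close>.\<close>

lemma arms_disjoint_aux:
  assumes b: "branches T \<noteq> {}" and l: "l \<in> leaves T" "l' \<in> leaves T"
  shows "i < arm_length l \<Longrightarrow> j < arm_length l' \<Longrightarrow> chain l ! i = chain l' ! j \<Longrightarrow> l = l'"
proof (induction i arbitrary: j)
  case 0
  have "degree_of T (chain l' ! j) = 1"
    using degree_arm[OF l(1) 0(1)] 0(3) by simp
  then have j: "j = 0" using degree_arm[OF l(2) 0(2)] by (metis numeral_One numeral_eq_iff semiring_norm(85))
  show ?case using 0(3) unfolding j chain_0[OF l(1)] chain_0[OF l(2)] .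
next
  case (Suc i)
  have j: "j \<noteq> 0" using Suc.prems degree_arm[OF l(1), of "Suc i"] degree_arm[OF l(2), of j]
    by (auto split: if_splits)
  have "chain l ! i \<in> nbrs T (chain l ! Suc i)"
    using nbrs_chain[OF l(1) Suc.prems(1)] by simp
  then have "chain l ! i = chain l' ! (j - 1) \<or> chain l ! i = chain l' ! Suc j"
    unfolding Suc.prems(3) using nbrs_chain[OF l(2) Suc.prems(2)] j by simp
  then show ?case
  proof
    assume "chain l ! i = chain l' ! (j - 1)"
    then show ?thesis using Suc.IH[of "j - 1"] Suc.prems by simp
  next
    assume e: "chain l ! i = chain l' ! Suc j"
    have "chain l ! i \<in> arm l" using Suc.prems by (simp add: arm_def)
    then have "chain l ! i \<notin> branches T" using arm_branches[OF l(1)] by blast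
    then have "Suc j \<noteq> arm_length l'" using e last_chain_branch[OF l(2) b] by auto
    then show ?thesis using Suc.IH[of "Suc j"] Suc.prems e by simp
  qed
qed

lemma arms_disjoint:
  "branches T \<noteq> {} \<Longrightarrow> l \<in> leaves T \<Longrightarrow> l' \<in> leaves T \<Longrightarrow> l \<noteq> l' \<Longrightarrow> arm l \<inter> arm l' = {}"
  using arms_disjoint_aux[of l l'] by (auto simp: arm_def)

lemma branches_core: "branches T \<subseteq> core"
  using arm_branches unfolding core_def branches_def by blast

text \<open>The sets obtained from the tree by cutting back arms from their leaves.\<close>

definition trimmed :: "'a set \<Rightarrow> bool" where
  "trimmed U \<longleftrightarrow> core \<subseteq> U \<and> U \<subseteq> verts T \<and>
    (\<forall>l\<in>leaves T. \<forall>i. Suc i < arm_length l \<longrightarrow> chain l ! i \<in> U \<longrightarrow> chain l ! Suc i \<in> U)"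

text \<open>The part of \<open>U\<close> at positions up to \<open>i\<close> can be left only at
  position \<open>i\<close>, towards \<open>chain l ! Suc i\<close>. It must be left, as
  \<open>U\<close> is connected and contains the branch vertex at the end.\<close>

lemma chain_step:
  assumes b: "branches T \<noteq> {}" and l: "l \<in> leaves T" and U: "U \<in> conn_sets T" "branches T \<subseteq> U"
    and i: "i < arm_length l" "chain l ! i \<in> U"
  shows "chain l ! Suc i \<in> U"
proof -
  let ?A = "U \<inter> (\<lambda>j. chain l ! j) ` {..i}"
  have "chain l ! arm_length l \<notin> ?A"
    using inj_onD[OF inj_chain[OF l], of "arm_length l"] i by fastforce
  then have "?A \<noteq> {}" "?A \<subset> U" using i last_chain_branch[OF l b] U(2) by blast+
  then obtain a c where ac: "a \<in> ?A" "c \<in> U - ?A" "c \<in> nbrs T a"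
    by (rule conn_sets_cut[OF U(1)])
  then obtain j where j: "j \<le> i" "a = chain l ! j" by auto
  then have "c = chain l ! Suc j \<or> (j > 0 \<and> c = chain l ! (j - 1))"
    using nbrs_chain[OF l, of j] i ac(3) by (auto split: if_splits)
  then have "c = chain l ! Suc j" using ac(2) j(1) by auto
  moreover have "j = i"
  proof (rule ccontr)
    assume "j \<noteq> i"
    then have "Suc j \<le> i" using j(1) by simp
    then show False using ac(2) \<open>c = chain l ! Suc j\<close> by blast
  qed
  ultimately show ?thesis using ac(2) by simp
qed

text \<open>Enlarge \<open>U\<close> to the whole tree by one adjacent vertex at a time; every added
  vertex \<open>v\<close> lies on an arm. It has just one neighbor in the enlarged set. If it has no
  other, it is a leaf; otherwise another neighbor is on an arm by induction, and \<open>v\<close>,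
  not being a branch vertex, is on the same arm.\<close>

lemma core_subset:
  assumes b: "branches T \<noteq> {}" and U: "U \<in> conn_sets T" "branches T \<subseteq> U"
  shows "core \<subseteq> U"
proof -
  have "verts T - U \<subseteq> (\<Union>l\<in>leaves T. arm l)"
    using U
  proof (induction "card (verts T - U)" arbitrary: U rule: less_induct)
    case less
    note D = conn_setsD[OF less.prems(1)]
    show ?case
    proof (cases "U = verts T")
      case False
      then obtain u v where uv: "u \<in> U" "v \<in> verts T - U" "v \<in> nbrs T u"
        using conn_sets_cut[OF verts_conn_sets, of U] D by blast
      let ?U = "insert v U"
      have C: "?U \<in> conn_sets T"
        using less.prems(1) uv connected_insert[of T U u v] by (auto simp: conn_sets_def)
      have "verts T - ?U \<subset> verts T - U" using uv by blast
      then have "card (verts T - ?U) < card (verts T - U)" using finite_verts by (intro psubset_card_mono) auto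
      then have IH: "verts T - ?U \<subseteq> (\<Union>l\<in>leaves T. arm l)"
        using less.hyps[of ?U] C less.prems(2) by blast
      have "?U - {v} = U" using uv by auto
      \<comment> \<open>Both sets are connected, so the number of edges grows by exactly one, like
        the number of vertices.\<close>
      then have "card (nbrs T v \<inter> ?U) = 1"
        using edges_in_remove[OF simple_T, of v ?U] conn_setsD(3,4)[OF C] D(3,4) uv(2) by simp
      moreover have "u \<in> nbrs T v" using uv by (simp add: nbrs_sym)
      ultimately have one: "nbrs T v \<inter> ?U = {u}" using uv
        by (metis IntI card_1_singletonE insertI2 singletonD)
      have "v \<in> (\<Union>l\<in>leaves T. arm l)"
      proof (cases "nbrs T v \<subseteq> ?U")
        case True
        then have "v \<in> leaves T" using one uv by (simp add: leaves_def degree_eq Int_absorb2)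
        moreover have "v \<in> arm v" unfolding arm_def
          using chain_0[OF calculation] arm_length_pos[OF calculation] by (intro image_eqI[of _ _ 0]) auto
        ultimately show ?thesis by blast
      next
        case False
        then obtain w where w: "w \<in> nbrs T v" "w \<notin> ?U" by blast
        then have "w \<in> verts T - ?U" using nbrs_verts[OF simple_T w(1)] by blast
        then obtain l i where l: "l \<in> leaves T" and i: "i < arm_length l" "w = chain l ! i"
          using IH by (auto simp: arm_def)
        have "v \<in> nbrs T w" using w(1) by (simp add: nbrs_sym)
        then have "v = chain l ! Suc i \<or> v = chain l ! (i - 1)"
          using nbrs_chain[OF l i(1)] i(2) by (auto split: if_splits)
        moreover have "v \<notin> branches T" using uv less.prems(2) by blast
        then have "v \<noteq> chain l ! arm_length l" using last_chain_branch[OF l b] by auto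
        ultimately have "\<exists>j<arm_length l. v = chain l ! j"
          using i(1) by (metis Suc_lessI less_imp_diff_less)
        then show ?thesis using l by (auto simp: arm_def)
      qed
      then show ?thesis using IH by blast
    qed simp
  qed
  then show ?thesis by (auto simp: core_def)
qed

text \<open>From right to left this is \<open>core_subset\<close> and \<open>chain_step\<close>. For
  connectedness of a trimmed set, induct on the number of missing vertices: putting one back gives a
  connected set in which it has at most one neighbor, so it can be taken away again.\<close>

lemma trimmed_iff:
  assumes b: "branches T \<noteq> {}"
  shows "trimmed U \<longleftrightarrow> U \<in> conn_sets T \<and> branches T \<subseteq> U"
proof
  assume "U \<in> conn_sets T \<and> branches T \<subseteq> U"
  then show "trimmed U"
    using core_subset[OF b] chain_step[OF b] conn_setsD(1) by (auto simp: trimmed_def)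
next
  assume "trimmed U"
  then have "U \<in> conn_sets T"
  proof (induction "card (verts T - U)" arbitrary: U rule: less_induct)
    case less
    have core: "core \<subseteq> U" and UV: "U \<subseteq> verts T"
      and up: "\<And>l i. l \<in> leaves T \<Longrightarrow> Suc i < arm_length l \<Longrightarrow> chain l ! i \<in> U \<Longrightarrow> chain l ! Suc i \<in> U"
      using less.prems by (auto simp: trimmed_def)
    show ?case
    proof (cases "U = verts T")
      case False
      then obtain l i where l: "l \<in> leaves T" and i: "i < arm_length l" "chain l ! i \<notin> U"
        using core UV by (fastforce simp: core_def arm_def)
      let ?I = "{i. i < arm_length l \<and> chain l ! i \<notin> U}"
      \<comment> \<open>The missing vertex of the arm closest to the core: later positions on the
        arm are present and, by upward closure, the preceding one is missing.\<close>
      define m where "m = Max ?I"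
      have "m \<in> ?I" unfolding m_def using i by (intro Max_in) auto
      then have m: "m < arm_length l" "chain l ! m \<notin> U" by auto
      have above: "chain l ! Suc m \<in> U" if "Suc m < arm_length l"
      proof (rule ccontr)
        assume "chain l ! Suc m \<notin> U"
        then have "Suc m \<le> m" unfolding m_def using that m_def by (intro Max_ge) auto
        then show False by simp
      qed
      have below: "chain l ! (m - 1) \<notin> U" if "m > 0"
        using up[OF l, of "m - 1"] m that by auto
      let ?v = "chain l ! m"
      have v: "?v \<in> verts T" using chain_verts[OF l, of m] m by simp
      have inj: "chain l ! j \<noteq> ?v" if "j \<noteq> m" "j \<le> arm_length l" for j
        using inj_chain[OF l] that m by (auto simp: inj_on_def)
      have "chain k ! Suc j \<in> insert ?v U"
        if k: "k \<in> leaves T" and j: "Suc j < arm_length k" "chain k ! j \<in> insert ?v U" for k j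
      proof (cases "chain k ! j \<in> U")
        case True then show ?thesis using up[OF k j(1)] by simp
      next
        case False
        then have e: "chain k ! j = ?v" using j(2) by simp
        then have "k = l" using arms_disjoint_aux[OF b k l, of j m] j m by simp
        then have "j = m" using inj[of j] e j by auto
        then show ?thesis using above j \<open>k = l\<close> by simp
      qed
      then have "trimmed (insert ?v U)" using core UV v by (auto simp: trimmed_def)
      moreover have "verts T - insert ?v U \<subset> verts T - U" using v m by blast
      then have "card (verts T - insert ?v U) < card (verts T - U)" using finite_verts by (intro psubset_card_mono) auto
      ultimately have C: "insert ?v U \<in> conn_sets T" using less.hyps by blast
      have "nbrs T ?v \<inter> insert ?v U \<subseteq> {chain l ! Suc m}"
        using nbrs_chain[OF l m(1)] below inj[of "m - 1"] m by (auto split: if_splits)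
      then have "card (nbrs T ?v \<inter> insert ?v U) \<le> 1"
        using card_mono[of "{chain l ! Suc m}"] by fastforce
      moreover have "insert ?v U - {?v} = U" "U \<noteq> {}" using m core branches_core b by auto
      ultimately have "connected_graph (induced T U)"
        using connected_remove[of T "insert ?v U" ?v] C simple_T by (auto simp: conn_sets_def)
      then show ?thesis using UV by (simp add: conn_sets_def)
    qed (simp add: verts_conn_sets)
  qed
  then show "U \<in> conn_sets T \<and> branches T \<subseteq> U"
    using branches_core \<open>trimmed U\<close> by (auto simp: trimmed_def)
qed

text \<open>The core is itself trimmed, hence connected, and \<open>core_subset\<close> places it
  inside every competitor.\<close>

lemma verts_trunk: "verts (trunk T) = (if branches T = {} then {} else core)"
proof (cases "branches T = {}")
  case False
  have "trimmed core" by (auto simp: trimmed_def core_def arm_def)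
  then have "core \<in> conn_sets T" using trimmed_iff[OF False] by blast
  then have "(LEAST U. U \<subseteq> verts T \<and> connected_graph (induced T U) \<and> branches T \<subseteq> U) = core"
    using branches_core core_subset[OF False] by (intro Least_equality) (auto simp: conn_sets_def)
  then show ?thesis using False by (simp add: trunk_def branches_def[symmetric])
qed (simp add: trunk_def branches_def[symmetric])

end

subsection \<open>Generating functions\<close>

lemma up_closed_eq_interval:
  assumes "I \<subseteq> {..<a}" "\<And>i. Suc i < a \<Longrightarrow> i \<in> I \<Longrightarrow> Suc i \<in> I"
  shows "I = {a - card I..<a}"
proof (cases "I = {}")
  case False
  have fin: "finite I" using assms(1) finite_subset by blast
  define m where "m = Min I"
  have m: "m \<in> I" unfolding m_def using fin False by simp
  have "i \<in> I" if "m \<le> i" "i < a" for i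
    using that by (induction i rule: dec_induct) (use m assms(2) in auto)
  moreover have "m \<le> i" if "i \<in> I" for i using that fin by (simp add: m_def)
  ultimately have I: "I = {m..<a}" using assms(1) by auto
  then show ?thesis using m by auto
qed simp

context tree_graph
begin

lemma inj_chain_less: "l \<in> leaves T \<Longrightarrow> inj_on (\<lambda>i. chain l ! i) {..<arm_length l}"
  using inj_chain by (rule inj_on_subset) auto

lemma finite_arm: "finite (arm l)" and card_arm: "l \<in> leaves T \<Longrightarrow> card (arm l) = arm_length l"
  using inj_chain_less by (auto simp: arm_def card_image)

lemma trimmed_arm:
  assumes "trimmed U" and l: "l \<in> leaves T"
  shows "U \<inter> arm l = (\<lambda>i. chain l ! i) ` {arm_length l - card (U \<inter> arm l)..<arm_length l}"
proof -
  let ?I = "{i. i < arm_length l \<and> chain l ! i \<in> U}"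
  have U: "U \<inter> arm l = (\<lambda>i. chain l ! i) ` ?I" by (auto simp: arm_def)
  moreover have "inj_on (\<lambda>i. chain l ! i) ?I" using inj_chain_less[OF l] by (rule inj_on_subset) auto
  ultimately have "card (U \<inter> arm l) = card ?I" by (simp add: card_image)
  moreover have "?I = {arm_length l - card ?I..<arm_length l}"
    using assms by (intro up_closed_eq_interval) (auto simp: trimmed_def)
  ultimately show ?thesis using U by simp
qed

lemma trimmed_decompose:
  assumes "trimmed U" shows "U = core \<union> (\<Union>l\<in>leaves T. U \<inter> arm l)"
  using assms by (auto simp: trimmed_def core_def)

lemma card_trimmed:
  assumes "branches T \<noteq> {}" "trimmed U"
  shows "card U = card core + (\<Sum>l\<in>leaves T. card (U \<inter> arm l))"
proof -
  have "card (\<Union>l\<in>leaves T. U \<inter> arm l) = (\<Sum>l\<in>leaves T. card (U \<inter> arm l))"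
    using finite_leaves finite_arm arms_disjoint[OF assms(1)] by (intro card_UN_disjoint) auto
  moreover have "card (core \<union> (\<Union>l\<in>leaves T. U \<inter> arm l)) = card core + card (\<Union>l\<in>leaves T. U \<inter> arm l)"
    using finite_leaves finite_arm finite_verts by (intro card_Un_disjoint) (auto simp: core_def)
  ultimately show ?thesis using trimmed_decompose[OF assms(2)] by simp
qed

text \<open>Inverse of the map that sends a trimmed set to the numbers of vertices it keeps on the
  arms; by \<open>trimmed_arm\<close> these are final segments.\<close>

definition trim :: "('a \<Rightarrow> nat) \<Rightarrow> 'a set" where
  "trim b = core \<union> (\<Union>l\<in>leaves T. (\<lambda>i. chain l ! i) ` {arm_length l - b l..<arm_length l})"

lemma trim_arm:
  assumes "branches T \<noteq> {}" and l: "l \<in> leaves T"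
  shows "trim b \<inter> arm l = (\<lambda>i. chain l ! i) ` {arm_length l - b l..<arm_length l}"
proof -
  have sub: "(\<lambda>i. chain k ! i) ` {arm_length k - b k..<arm_length k} \<subseteq> arm k" for k
    by (auto simp: arm_def)
  have "core \<inter> arm l = {}" using l by (auto simp: core_def)
  moreover have "(\<lambda>i. chain k ! i) ` {arm_length k - b k..<arm_length k} \<inter> arm l = {}"
    if "k \<in> leaves T" "k \<noteq> l" for k
    using arms_disjoint[OF assms(1) that(1) l that(2)] sub[of k] by blast
  ultimately show ?thesis using sub[of l] l unfolding trim_def by blast
qed

lemma trimmed_trim:
  assumes "branches T \<noteq> {}" shows "trimmed (trim b)"
  unfolding trimmed_def
proof (intro conjI ballI allI impI)
  show "core \<subseteq> trim b" by (auto simp: trim_def)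
  show "trim b \<subseteq> verts T" using chain_verts by (auto simp: trim_def core_def)
  fix l i assume l: "l \<in> leaves T" and i: "Suc i < arm_length l" "chain l ! i \<in> trim b"
  have "chain l ! i \<in> trim b \<inter> arm l" using i by (simp add: arm_def)
  then obtain j where j: "arm_length l - b l \<le> j" "j < arm_length l" "chain l ! i = chain l ! j"
    unfolding trim_arm[OF assms l] by auto
  then have "i = j" using inj_onD[OF inj_chain_less[OF l], of i j] i by simp
  then have "chain l ! Suc i \<in> trim b \<inter> arm l"
    unfolding trim_arm[OF assms l] using i j by auto
  then show "chain l ! Suc i \<in> trim b" by blast
qed

text \<open>Trimmed sets correspond to independent choices of the number of vertices kept on each
  arm, so the sum factors over the leaves. Two choices of \<open>B l\<close> matter:
  \<open>{..<arm_length l}\<close> to avoid the leaves of the tree, \<open>{1..arm_length l}\<close>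
  to keep a vertex of each arm.\<close>

lemma trimmed_generating_function:
  fixes x :: "'c :: comm_semiring_1"
  assumes b: "branches T \<noteq> {}" and B: "\<And>l. l \<in> leaves T \<Longrightarrow> B l \<subseteq> {..arm_length l}"
  shows "(\<Sum>U | trimmed U \<and> (\<forall>l\<in>leaves T. card (U \<inter> arm l) \<in> B l). x ^ card U) =
    x ^ card core * (\<Prod>l\<in>leaves T. \<Sum>j\<in>B l. x ^ j)"
proof -
  let ?F = "{U. trimmed U \<and> (\<forall>l\<in>leaves T. card (U \<inter> arm l) \<in> B l)}"
  let ?h = "\<lambda>U. \<lambda>l\<in>leaves T. card (U \<inter> arm l)"
  have card_trim: "card (trim \<beta> \<inter> arm l) = \<beta> l" if "\<beta> \<in> PiE (leaves T) B" "l \<in> leaves T" for \<beta> l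
  proof -
    have "\<beta> l \<le> arm_length l" using that B by (auto dest: PiE_mem)
    moreover have "inj_on (\<lambda>i. chain l ! i) {arm_length l - \<beta> l..<arm_length l}"
      using inj_chain_less[OF that(2)] by (rule inj_on_subset) auto
    ultimately show ?thesis by (simp add: trim_arm[OF b that(2)] card_image)
  qed
  have "bij_betw ?h ?F (PiE (leaves T) B)"
  proof (rule bij_betw_byWitness[where f' = trim])
    show "\<forall>U\<in>?F. trim (?h U) = U"
    proof
      fix U assume "U \<in> ?F"
      then have U: "trimmed U" by simp
      have "trim (?h U) = core \<union> (\<Union>l\<in>leaves T. U \<inter> arm l)"
        unfolding trim_def using trimmed_arm[OF U] by simp
      then show "trim (?h U) = U" using trimmed_decompose[OF U] by simp
    qed
    show "\<forall>\<beta>\<in>PiE (leaves T) B. ?h (trim \<beta>) = \<beta>"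
      using card_trim by (auto simp: fun_eq_iff PiE_def extensional_def)
    show "?h ` ?F \<subseteq> PiE (leaves T) B" by auto
    show "trim ` PiE (leaves T) B \<subseteq> ?F" using trimmed_trim[OF b] card_trim by (auto dest: PiE_mem)
  qed
  then have "(\<Sum>\<beta>\<in>PiE (leaves T) B. x ^ card core * (\<Prod>l\<in>leaves T. x ^ \<beta> l)) =
      (\<Sum>U\<in>?F. x ^ card core * (\<Prod>l\<in>leaves T. x ^ ?h U l))"
    by (rule sum.reindex_bij_betw[symmetric])
  also have "\<dots> = (\<Sum>U\<in>?F. x ^ card U)"
    using card_trimmed[OF b] by (intro sum.cong refl) (simp add: power_add power_sum)
  finally have "(\<Sum>U\<in>?F. x ^ card U) = x ^ card core * (\<Sum>\<beta>\<in>PiE (leaves T) B. \<Prod>l\<in>leaves T. x ^ \<beta> l)"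
    by (simp add: sum_distrib_left)
  also have "(\<Sum>\<beta>\<in>PiE (leaves T) B. \<Prod>l\<in>leaves T. x ^ \<beta> l) = (\<Prod>l\<in>leaves T. \<Sum>j\<in>B l. x ^ j)"
    using finite_leaves B finite_subset[OF B] by (intro prod_sum_PiE[symmetric]) auto
  finally show ?thesis .
qed

lemma leaf_in_trimmed_iff:
  assumes "trimmed U" and l: "l \<in> leaves T"
  shows "l \<in> U \<longleftrightarrow> card (U \<inter> arm l) \<ge> arm_length l"
proof
  assume "l \<in> U"
  have "chain l ! i \<in> U" if "i < arm_length l" for i
    using that
  proof (induction i)
    case 0
    then show ?case using \<open>l \<in> U\<close> chain_0[OF l] by simp
  next
    case (Suc i)
    then show ?case using assms by (simp add: trimmed_def)
  qed
  then have "U \<inter> arm l = arm l" by (auto simp: arm_def)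
  then show "card (U \<inter> arm l) \<ge> arm_length l" by (simp add: card_arm[OF l])
next
  assume "card (U \<inter> arm l) \<ge> arm_length l"
  then have "arm l \<subseteq> U" using card_seteq[OF finite_arm, of "U \<inter> arm l" l] card_arm[OF l] by auto
  moreover have "chain l ! 0 \<in> arm l" unfolding arm_def using arm_length_pos[OF l] by (intro imageI) simp
  ultimately show "l \<in> U" using chain_0[OF l] by auto
qed

lemma boundary_generating_function:
  fixes x :: "'c :: comm_semiring_1"
  assumes n: "card (verts T) \<ge> 2" and b: "branches T \<noteq> {}"
  shows "(\<Sum>U | U \<in> conn_sets T \<and> card (boundary T U) = card (leaves T). x ^ card U) =
    x ^ card core * (\<Prod>l\<in>leaves T. \<Sum>j<arm_length l. x ^ j)"
proof -
  have "U \<in> conn_sets T \<and> card (boundary T U) = card (leaves T) \<longleftrightarrow>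
      trimmed U \<and> (\<forall>l\<in>leaves T. card (U \<inter> arm l) \<in> {..<arm_length l})" for U
  proof -
    have "U \<inter> leaves T = {} \<longleftrightarrow> (\<forall>l\<in>leaves T. card (U \<inter> arm l) \<in> {..<arm_length l})" if "trimmed U"
      unfolding disjoint_iff lessThan_iff not_le[symmetric] using leaf_in_trimmed_iff[OF that] by blast
    then show ?thesis using boundary_maximal_iff[OF n, of U] trimmed_iff[OF b, of U] by blast
  qed
  then show ?thesis by (subst trimmed_generating_function[OF b, symmetric]) auto
qed

text \<open>A neighbor of a branch vertex lies in the core or is the last vertex of an arm, the one
  that a trimmed set keeps if it keeps any of that arm. Conversely, the last vertex of every arm is
  adjacent to a branch vertex.\<close>

lemma nbrs_branches_subset_iff:
  assumes b: "branches T \<noteq> {}" and U: "trimmed U"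
  shows "(\<forall>v\<in>branches T. nbrs T v \<subseteq> U) \<longleftrightarrow> (\<forall>l\<in>leaves T. card (U \<inter> arm l) \<ge> 1)"
proof
  assume N: "\<forall>v\<in>branches T. nbrs T v \<subseteq> U"
  show "\<forall>l\<in>leaves T. card (U \<inter> arm l) \<ge> 1"
  proof
    fix l assume l: "l \<in> leaves T"
    let ?i = "arm_length l - 1"
    have "chain l ! ?i \<in> nbrs T (chain l ! arm_length l)"
      using is_path_nth(2)[OF path_chain[OF l], of ?i] length_chain[OF l] arm_length_pos[OF l] by simp
    then have "chain l ! ?i \<in> U" using N last_chain_branch[OF l b] by blast
    moreover have "chain l ! ?i \<in> arm l" unfolding arm_def using arm_length_pos[OF l] by (intro imageI) simp
    ultimately have "card (U \<inter> arm l) \<noteq> 0" using finite_arm by auto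
    then show "card (U \<inter> arm l) \<ge> 1" by simp
  qed
next
  assume c: "\<forall>l\<in>leaves T. card (U \<inter> arm l) \<ge> 1"
  show "\<forall>v\<in>branches T. nbrs T v \<subseteq> U"
  proof (intro ballI subsetI, rule ccontr)
    fix v w assume v: "v \<in> branches T" and w: "w \<in> nbrs T v" "w \<notin> U"
    have "w \<in> verts T" using nbrs_verts[OF simple_T w(1)] by blast
    then have "w \<in> (\<Union>l\<in>leaves T. arm l)" using w(2) U by (auto simp: core_def trimmed_def)
    then obtain l i where l: "l \<in> leaves T" and i: "i < arm_length l" "w = chain l ! i"
      by (auto simp: arm_def)
    have "v \<in> nbrs T w" using w(1) by (simp add: nbrs_sym)
    then have "v = chain l ! Suc i \<or> v = chain l ! (i - 1)"
      using nbrs_chain[OF l i(1)] i(2) by (auto split: if_splits)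
    moreover have "chain l ! j \<noteq> v" if "j < arm_length l" for j
      using arm_branches[OF l] v that by (auto simp: arm_def)
    ultimately have "Suc i = arm_length l" using i(1) by (metis Suc_lessI less_imp_diff_less)
    moreover have "chain l ! (arm_length l - 1) \<in> U \<inter> arm l"
      by (subst trimmed_arm[OF U l]) (use c l arm_length_pos[OF l] in \<open>auto intro!: imageI\<close>)
    ultimately show False using w(2) i by (metis IntD1 diff_Suc_1)
  qed
qed

text \<open>Having as many leaves as the tree means keeping at least one vertex of every arm; this
  obligatory vertex contributes a factor \<open>x\<close> per leaf.\<close>

lemma leaves_generating_function:
  fixes x :: "'c :: comm_semiring_1"
  assumes b: "branches T \<noteq> {}"
  shows "(\<Sum>U | U \<in> conn_sets T \<and> card U \<ge> 2 \<and> card (leaves (induced T U)) = card (leaves T). x ^ card U) =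
    x ^ (card (leaves T) + card core) * (\<Prod>l\<in>leaves T. \<Sum>j<arm_length l. x ^ j)"
proof -
  have two: "card U \<ge> 2" if "U \<in> conn_sets T" "branches T \<subseteq> U" "\<forall>v\<in>branches T. nbrs T v \<subseteq> U" for U
  proof -
    obtain v where v: "v \<in> branches T" using b by blast
    then have "nbrs T v \<subseteq> U" "card (nbrs T v) \<ge> 3" using that(3) by (auto simp: branches_def degree_eq)
    then show ?thesis using card_mono[OF conn_setsD(3)[OF that(1)], of "nbrs T v"] by linarith
  qed
  have "U \<in> conn_sets T \<and> card U \<ge> 2 \<and> card (leaves (induced T U)) = card (leaves T) \<longleftrightarrow>
      trimmed U \<and> (\<forall>v\<in>branches T. nbrs T v \<subseteq> U)" for U
    using card_leaves_induced(2)[of U] trimmed_iff[OF b, of U] two[of U] by blast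
  moreover have "card (U \<inter> arm l) \<le> arm_length l" if "l \<in> leaves T" for U l
    using card_mono[OF finite_arm, of "U \<inter> arm l" l] card_arm[OF that] by auto
  ultimately have "U \<in> conn_sets T \<and> card U \<ge> 2 \<and> card (leaves (induced T U)) = card (leaves T) \<longleftrightarrow>
      trimmed U \<and> (\<forall>l\<in>leaves T. card (U \<inter> arm l) \<in> {1..arm_length l})" for U
    using nbrs_branches_subset_iff[OF b, of U] by auto
  then have "(\<Sum>U | U \<in> conn_sets T \<and> card U \<ge> 2 \<and> card (leaves (induced T U)) = card (leaves T). x ^ card U) =
      x ^ card core * (\<Prod>l\<in>leaves T. \<Sum>j\<in>{1..arm_length l}. x ^ j)"
    by (subst trimmed_generating_function[OF b, symmetric]) auto
  also have "(\<lambda>l. \<Sum>j\<in>{1..arm_length l}. x ^ j) = (\<lambda>l. x * (\<Sum>j<arm_length l. x ^ j))"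
  proof
    have "(\<Sum>j\<in>{1..a}. x ^ j) = x * (\<Sum>j<a. x ^ j)" for a
      by (induction a) (simp_all add: algebra_simps)
    then show "(\<Sum>j\<in>{1..arm_length l}. x ^ j) = x * (\<Sum>j<arm_length l. x ^ j)" for l .
  qed
  finally show ?thesis by (simp add: prod.distrib power_add mult_ac)
qed

end

section \<open>Recovering the exponents from the product\<close>

lemma coeff_sum_X_power:
  assumes "finite F"
  shows "coeff (\<Sum>U\<in>F. [:0, 1 :: 'b :: comm_semiring_1:] ^ card U) k = of_nat (card {U \<in> F. card U = k})"
proof -
  have "[:0, 1:] ^ n = (monom 1 n :: 'b poly)" for n by (simp add: monom_altdef)
  then show ?thesis using assms by (simp add: coeff_sum sum.If_cases Int_def)
qed

lemma coeff_0_prod_one_minus_X_power: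
  "0 \<notin># A \<Longrightarrow> coeff (\<Prod>a\<in>#A. 1 - monom (1::int) a) 0 = 1"
  by (induction A) (auto simp: coeff_mult_0)

text \<open>With no exponent below \<open>m\<close>, the product is \<open>1 - c * X ^ m\<close> up
  to degree \<open>m\<close>, where \<open>c\<close> is the multiplicity of \<open>m\<close>: terms
  from two or more factors have degree at least \<open>2 * m\<close>.\<close>

lemma coeff_prod_one_minus_X_power:
  assumes "m \<ge> 1" "\<forall>a\<in>#A. a \<ge> m" "i \<le> m"
  shows "coeff (\<Prod>a\<in>#A. 1 - monom (1::int) a) i =
    (if i = 0 then 1 else if i < m then 0 else - int (count A m))"
  using assms(2,3)
proof (induction A arbitrary: i)
  case (add a A)
  have a: "a \<ge> m" and IH: "\<And>i. i \<le> m \<Longrightarrow> coeff (\<Prod>a\<in>#A. 1 - monom (1::int) a) i =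
    (if i = 0 then 1 else if i < m then 0 else - int (count A m))"
    using add by auto
  have "coeff (\<Prod>a\<in>#add_mset a A. 1 - monom (1::int) a) i =
      coeff (\<Prod>a\<in>#A. 1 - monom (1::int) a) i -
      (if a \<le> i then coeff (\<Prod>a\<in>#A. 1 - monom (1::int) a) (i - a) else 0)"
    by (simp add: left_diff_distrib coeff_monom_mult)
  then show ?case using IH[of i] IH[of 0] a add.prems(2) assms(1) by (auto simp: le_antisym)
qed (use assms in auto)

text \<open>Cancel the common factors, whose product is nonzero since its constant coefficient is 1.
  The smallest exponent left then has equal multiplicity in \<open>A - B\<close> and
  \<open>B - A\<close>; these are disjoint, so it would occur in neither.\<close>

lemma prod_one_minus_X_power_inject:
  assumes "0 \<notin># A" "0 \<notin># B"
    and eq: "(\<Prod>a\<in>#A. 1 - monom (1::int) a) = (\<Prod>a\<in>#B. 1 - monom 1 a)"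
  shows "A = B"
proof (rule ccontr)
  let ?P = "\<lambda>M. \<Prod>a\<in>#M. 1 - monom (1::int) a"
  assume "A \<noteq> B"
  define C where "C = (A - B) + (B - A)"
  have "C \<noteq> {#}" using \<open>A \<noteq> B\<close>
    by (metis C_def Diff_eq_empty_iff_mset subset_mset.antisym union_eq_empty)
  define m where "m = Min (set_mset C)"
  have m: "m \<in># C" and min: "\<And>a. a \<in># C \<Longrightarrow> m \<le> a" using \<open>C \<noteq> {#}\<close> by (auto simp: m_def)
  have "0 \<notin># C" using assms(1,2) by (auto simp: C_def dest: in_diffD)
  then have m1: "m \<ge> 1" using m by (cases m) auto
  have pos: "?P M \<noteq> 0" if "0 \<notin># M" for M
    using coeff_0_prod_one_minus_X_power[OF that] by (metis coeff_0 zero_neq_one)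
  have "A = (A \<inter># B) + (A - B)" "B = (A \<inter># B) + (B - A)"
    by (rule multiset_eqI; simp)+
  from this[THEN arg_cong[of _ _ ?P]]
  have "?P A = ?P (A \<inter># B) * ?P (A - B)" "?P B = ?P (A \<inter># B) * ?P (B - A)"
    by (simp_all only: image_mset_union prod_mset_Un)
  moreover have "?P (A \<inter># B) \<noteq> 0" using assms by (intro pos) auto
  ultimately have "?P (A - B) = ?P (B - A)" using eq by simp
  then have "coeff (?P (A - B)) m = coeff (?P (B - A)) m" by simp
  then have "count (A - B) m = count (B - A) m"
    using coeff_prod_one_minus_X_power[OF m1, of "A - B" m] coeff_prod_one_minus_X_power[OF m1, of "B - A" m] m1 min
    by (auto simp: C_def)
  then have "count C m = 0" by (auto simp: C_def)
  then show False using m by (simp add: count_eq_zero_iff)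
qed

lemma X_power_mult_inject:
  fixes p q :: "int poly"
  assumes "monom 1 s * p = monom 1 t * q" "coeff p 0 \<noteq> 0" "coeff q 0 \<noteq> 0"
  shows "s = t"
proof -
  have "coeff (monom 1 s * p) i = coeff (monom 1 t * q) i" for i using assms(1) by simp
  from this[of s] this[of t] show ?thesis
    using assms(2,3) by (auto simp: coeff_monom_mult split: if_splits)
qed

text \<open>Multiplying each geometric sum by \<open>1 - X\<close> gives \<open>1 - X ^ a\<close>;
  equal sizes make the total multiplier the same on both sides.\<close>

lemma arm_lengths_determined:
  fixes A B :: "nat multiset"
  assumes "0 \<notin># A" "0 \<notin># B" "size A = size B"
    and eq: "[:0, 1::int:] ^ s * (\<Prod>a\<in>#A. \<Sum>j<a. [:0, 1:] ^ j) = [:0, 1:] ^ t * (\<Prod>a\<in>#B. \<Sum>j<a. [:0, 1:] ^ j)"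
  shows "s = t \<and> A = B"
proof -
  let ?X = "[:0, 1::int:]"
  let ?Q = "\<lambda>M. \<Prod>a\<in>#M. \<Sum>j<a. ?X ^ j" and ?P = "\<lambda>M. \<Prod>a\<in>#M. 1 - monom (1::int) a"
  have X: "?X ^ k = monom 1 k" for k by (simp add: monom_altdef)
  have QP: "(1 - ?X) ^ size M * ?Q M = ?P M" for M
  proof (induction M)
    case (add a M)
    have "(1 - ?X) * (\<Sum>j<a. ?X ^ j) = 1 - monom 1 a"
      by (simp only: one_diff_power_eq[symmetric] X[symmetric])
    then show ?case using add by (simp add: mult_ac)
  qed simp
  have "(1 - ?X) ^ size A * (?X ^ s * ?Q A) = (1 - ?X) ^ size B * (?X ^ t * ?Q B)"
    using eq assms(3) by simp
  then have "monom 1 s * ?P A = monom 1 t * ?P B"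
    unfolding QP[symmetric] X by (simp only: mult_ac)
  then have "s = t" "?P A = ?P B"
    using X_power_mult_inject[of s "?P A" t "?P B"]
      coeff_0_prod_one_minus_X_power[OF assms(1)] coeff_0_prod_one_minus_X_power[OF assms(2)] by auto
  then show ?thesis using prod_one_minus_X_power_inject assms by blast
qed

text \<open>The common end of both arguments: single vertices and paths are settled by the numbers
  of vertices and leaves, other trees by the generating function. The shift \<open>c\<close> is the
  number of leaves for the subtree polynomial and 0 for the chromatic symmetric function.\<close>

lemma trunk_twigs_determined:
  fixes T1 :: "'a ugraph" and T2 :: "'b ugraph"
  assumes "is_tree T1" "is_tree T2" and n: "card (verts T1) = card (verts T2)"
    and L: "card (verts T1) \<ge> 2 \<Longrightarrow> card (leaves T1) = card (leaves T2)"
    and gf: "card (verts T1) \<ge> 2 \<Longrightarrow> branches T1 \<noteq> {} \<Longrightarrow> branches T2 \<noteq> {} \<Longrightarrow>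
      [:0, 1::int:] ^ (c + card (tree_graph.core T1)) *
        (\<Prod>l\<in>leaves T1. \<Sum>j<tree_graph.arm_length T1 l. [:0, 1:] ^ j) =
      [:0, 1:] ^ (c + card (tree_graph.core T2)) *
        (\<Prod>l\<in>leaves T2. \<Sum>j<tree_graph.arm_length T2 l. [:0, 1:] ^ j)"
  shows "card (verts (trunk T1)) = card (verts (trunk T2)) \<and> twig_lengths T1 = twig_lengths T2"
proof -
  interpret t1: tree_graph T1 by unfold_locales fact
  interpret t2: tree_graph T2 by unfold_locales fact
  have m: "card (edges T1) = card (edges T2)"
    using tree_card_edges[OF assms(1)] tree_card_edges[OF assms(2)] n by simp
  show ?thesis
  proof (cases "card (verts T1) \<ge> 2")
    case False
    then have "card (edges T1) = 0" "card (edges T2) = 0"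
      using tree_card_edges[OF assms(1)] m by linarith+
    then have "edges T1 = {}" "edges T2 = {}"
      using finite_edges[OF t1.simple_T] finite_edges[OF t2.simple_T] by auto
    then have "branches T1 = {}" "branches T2 = {}" "leaves T1 = {}" "leaves T2 = {}"
      by (auto simp: branches_def leaves_def degree_of_def)
    then show ?thesis
      by (simp add: t1.verts_trunk t2.verts_trunk twig_lengths_def t1.twigs_eq t2.twigs_eq)
  next
    case n2: True
    have b: "branches T1 = {} \<longleftrightarrow> branches T2 = {}"
      using t1.branches_empty_iff t2.branches_empty_iff n2 n L by simp
    show ?thesis
    proof (cases "branches T1 = {}")
      case True
      then show ?thesis using b n2 n m
        by (simp add: t1.verts_trunk t2.verts_trunk t1.twig_lengths_path t2.twig_lengths_path)
    next
      case False
      let ?A = "image_mset t1.arm_length (mset_set (leaves T1))"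
      let ?B = "image_mset t2.arm_length (mset_set (leaves T2))"
      have "0 \<notin># ?A" "0 \<notin># ?B"
        using t1.arm_length_pos t2.arm_length_pos t1.finite_leaves t2.finite_leaves by fastforce+
      moreover have "size ?A = size ?B" using L[OF n2] by simp
      ultimately have "c + card t1.core = c + card t2.core \<and> ?A = ?B"
        using gf[OF n2 False] False b
        by (intro arm_lengths_determined) (auto simp: prod_unfold_prod_mset multiset.map_comp comp_def)
      then show ?thesis using False b
        by (simp add: t1.verts_trunk t2.verts_trunk t1.twig_lengths_branched t2.twig_lengths_branched)
    qed
  qed
qed

section \<open>Coefficients of the subtree polynomial\<close>

lemma subtree_poly_eq:
  assumes "is_tree T"
  shows "subtree_poly T = (\<Sum>U | U \<in> conn_sets T \<and> card U \<ge> 2.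
    monom (monom 1 (card (leaves (induced T U)))) (card U - 1))"
proof -
  interpret tree_graph T by unfold_locales fact
  \<comment> \<open>A connected set has one edge less than vertices, so subtrees, which must have an
    edge, correspond to connected sets of size at least 2.\<close>
  have ne: "edges (induced T U) \<noteq> {} \<longleftrightarrow> card U \<ge> 2" if "U \<in> conn_sets T" for U
  proof -
    have "finite (edges_in T U)" using finite_edges[OF simple_T] by (simp add: edges_in_def)
    then have "edges_in T U = {} \<longleftrightarrow> card (edges_in T U) = 0" by simp
    then show ?thesis using conn_setsD(4)[OF that] unfolding induced_simps by linarith
  qed
  have "subtrees T = induced T ` {U \<in> conn_sets T. card U \<ge> 2}"
    unfolding subtrees_def using ne unfolding conn_sets_def by blast
  moreover have "inj_on (induced T) F" for F
    by (rule inj_on_inverseI[of _ verts]) simp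
  ultimately have "subtree_poly T = (\<Sum>U | U \<in> conn_sets T \<and> card U \<ge> 2.
      monom (monom 1 (card (leaves (induced T U)))) (card (edges (induced T U))))"
    by (simp add: subtree_poly_def sum.reindex)
  also have "\<dots> = (\<Sum>U | U \<in> conn_sets T \<and> card U \<ge> 2.
      monom (monom 1 (card (leaves (induced T U)))) (card U - 1))"
  proof (rule sum.cong[OF refl])
    fix U assume "U \<in> {U. U \<in> conn_sets T \<and> card U \<ge> 2}"
    then have "card (edges_in T U) = card U - 1" using conn_setsD(4)[of U] by simp
    then show "monom (monom (1::int) (card (leaves (induced T U)))) (card (edges (induced T U))) =
      monom (monom 1 (card (leaves (induced T U)))) (card U - 1)" by simp
  qed
  finally show ?thesis .
qed

lemma coeff_subtree_poly:
  assumes "is_tree T"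
  shows "coeff (coeff (subtree_poly T) e) j =
    int (card {U \<in> conn_sets T. card U \<ge> 2 \<and> card U = Suc e \<and> card (leaves (induced T U)) = j})"
proof -
  interpret tree_graph T by unfold_locales fact
  have "finite {U \<in> conn_sets T. card U \<ge> 2}" using finite_verts by (simp add: conn_sets_def)
  moreover have "coeff (coeff (subtree_poly T) e) j = (\<Sum>U | U \<in> conn_sets T \<and> card U \<ge> 2.
      if card U = Suc e \<and> card (leaves (induced T U)) = j then 1 else 0)"
    unfolding subtree_poly_eq[OF assms] coeff_sum by (intro sum.cong) auto
  ultimately show ?thesis by (simp add: sum.If_cases Int_def conj_assoc)
qed

lemma count_twig_lengths:
  assumes "is_tree T"
  shows "card {P \<in> twigs T. card (edges P) = i} = count (twig_lengths T) i"
proof -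
  interpret tree_graph T by unfold_locales fact
  show ?thesis using finite_twigs
    by (simp add: twig_lengths_def count_image_mset Int_def vimage_def conj_commute)
qed

text \<open>The vertex set of \<open>T1\<close> is itself among the sets counted, so
  \<open>T2\<close> has a connected set with as many vertices and leaves as \<open>T1\<close>. Used
  in both directions, this gives equality.\<close>

lemma verts_leaves_le:
  fixes T1 :: "'a ugraph" and T2 :: "'b ugraph"
  assumes "is_tree T1" "is_tree T2" "card (verts T1) \<ge> 2"
    and eq: "\<And>k j. card {U \<in> conn_sets T1. card U \<ge> 2 \<and> card U = k \<and> card (leaves (induced T1 U)) = j} =
      card {U \<in> conn_sets T2. card U \<ge> 2 \<and> card U = k \<and> card (leaves (induced T2 U)) = j}"
  shows "card (verts T1) \<le> card (verts T2) \<and> card (leaves T1) \<le> card (leaves T2)"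
proof -
  interpret t1: tree_graph T1 by unfold_locales fact
  interpret t2: tree_graph T2 by unfold_locales fact
  define F where "F = {U \<in> conn_sets T1. card U \<ge> 2 \<and> card U = card (verts T1) \<and>
    card (leaves (induced T1 U)) = card (leaves T1)}"
  have "verts T1 \<in> F" using t1.verts_conn_sets assms(3) by (simp add: F_def induced_verts t1.simple_T)
  moreover have "finite F" using t1.finite_verts by (simp add: F_def conn_sets_def)
  ultimately have "card F \<noteq> 0" by auto
  then obtain U where U: "U \<in> conn_sets T2" "card U \<ge> 2" "card U = card (verts T1)"
      "card (leaves (induced T2 U)) = card (leaves T1)"
    unfolding F_def eq by (metis (mono_tags, lifting) card.empty empty_Collect_eq)
  then show ?thesis
    using card_mono[OF t2.finite_verts t2.conn_setsD(1)[OF U(1)]] t2.card_leaves_induced(1)[OF U(1,2)] by simp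
qed

lemma subtree_poly_determines:
  fixes T1 :: "'a ugraph" and T2 :: "'b ugraph"
  assumes "is_tree T1" "is_tree T2" "subtree_poly T1 = subtree_poly T2"
  shows "card (verts (trunk T1)) = card (verts (trunk T2)) \<and> twig_lengths T1 = twig_lengths T2"
proof -
  interpret t1: tree_graph T1 by unfold_locales fact
  interpret t2: tree_graph T2 by unfold_locales fact
  have eq: "card {U \<in> conn_sets T1. card U \<ge> 2 \<and> card U = k \<and> card (leaves (induced T1 U)) = j} =
      card {U \<in> conn_sets T2. card U \<ge> 2 \<and> card U = k \<and> card (leaves (induced T2 U)) = j}" for k j
  \<comment> \<open>For \<open>k = Suc e\<close> this is a coefficient at degree \<open>e\<close>,
    the number of edges; for \<open>k = 0\<close> both sides count nothing.\<close>
  proof (cases k)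
    case (Suc e)
    then show ?thesis
      using coeff_subtree_poly[OF assms(1), of e j] coeff_subtree_poly[OF assms(2), of e j] assms(3) by simp
  qed (simp cong: conj_cong)
  show ?thesis
  proof (rule trunk_twigs_determined[OF assms(1,2), where c = "card (leaves T1)"])
    have ge1: "card (verts T1) \<ge> 1" "card (verts T2) \<ge> 1"
      using tree_card_edges[OF assms(1)] tree_card_edges[OF assms(2)] by linarith+
    show "card (verts T1) = card (verts T2)"
      using verts_leaves_le[OF assms(1,2) _ eq] verts_leaves_le[OF assms(2,1) _ eq[symmetric]] ge1 by linarith
    then show L: "card (leaves T1) = card (leaves T2)" if "card (verts T1) \<ge> 2"
      using verts_leaves_le[OF assms(1,2) _ eq] verts_leaves_le[OF assms(2,1) _ eq[symmetric]] that by (simp add: le_antisym)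
    assume n: "card (verts T1) \<ge> 2" and b: "branches T1 \<noteq> {}" "branches T2 \<noteq> {}"
    have "(\<Sum>U | U \<in> conn_sets T1 \<and> card U \<ge> 2 \<and> card (leaves (induced T1 U)) = card (leaves T1). [:0, 1::int:] ^ card U) =
        (\<Sum>U | U \<in> conn_sets T2 \<and> card U \<ge> 2 \<and> card (leaves (induced T2 U)) = card (leaves T2). [:0, 1:] ^ card U)"
    proof (rule poly_eqI)
      fix k
      have fin: "finite {U. U \<in> conn_sets T1 \<and> card U \<ge> 2 \<and> card (leaves (induced T1 U)) = card (leaves T1)}"
          "finite {U. U \<in> conn_sets T2 \<and> card U \<ge> 2 \<and> card (leaves (induced T2 U)) = card (leaves T2)}"
        using t1.finite_verts t2.finite_verts by (auto simp: conn_sets_def)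
      show "coeff (\<Sum>U | U \<in> conn_sets T1 \<and> card U \<ge> 2 \<and> card (leaves (induced T1 U)) = card (leaves T1). [:0, 1::int:] ^ card U) k =
          coeff (\<Sum>U | U \<in> conn_sets T2 \<and> card U \<ge> 2 \<and> card (leaves (induced T2 U)) = card (leaves T2). [:0, 1:] ^ card U) k"
        unfolding coeff_sum_X_power[OF fin(1)] coeff_sum_X_power[OF fin(2)]
        using eq[of k "card (leaves T1)"] L[OF n] by (simp add: conj_ac)
    qed
    then show "[:0, 1::int:] ^ (card (leaves T1) + card t1.core) * (\<Prod>l\<in>leaves T1. \<Sum>j<t1.arm_length l. [:0, 1:] ^ j) =
        [:0, 1:] ^ (card (leaves T1) + card t2.core) * (\<Prod>l\<in>leaves T2. \<Sum>j<t2.arm_length l. [:0, 1:] ^ j)"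
      unfolding t1.leaves_generating_function[OF b(1)] t2.leaves_generating_function[OF b(2)]
      by (simp only: L[OF n])
  qed
qed

lemma chromatic_symmetric_determines_trunk_twigs:
  fixes T1 :: "'a ugraph" and T2 :: "'b ugraph"
  assumes "is_tree T1" "is_tree T2" "chromatic_symmetric T1 = chromatic_symmetric T2"
  shows "card (verts (trunk T1)) = card (verts (trunk T2)) \<and> twig_lengths T1 = twig_lengths T2"
proof -
  interpret t1: tree_graph T1 by unfold_locales fact
  interpret t2: tree_graph T2 by unfold_locales fact
  note n = chromatic_symmetric_determines(1)[OF assms]
  note N = chromatic_symmetric_determines(2)[OF assms]
  have L: "card (leaves T1) = card (leaves T2)"
    unfolding t1.card_leaves_eq_boundary t2.card_leaves_eq_boundary by (rule N) simp
  show ?thesis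
  proof (rule trunk_twigs_determined[OF assms(1,2) n L, where c = 0])
    assume n2: "card (verts T1) \<ge> 2" and b: "branches T1 \<noteq> {}" "branches T2 \<noteq> {}"
    have "(\<Sum>U | U \<in> conn_sets T1 \<and> card (boundary T1 U) = card (leaves T1). [:0, 1::int:] ^ card U) =
        (\<Sum>U | U \<in> conn_sets T2 \<and> card (boundary T2 U) = card (leaves T2). [:0, 1:] ^ card U)"
    proof (rule poly_eqI)
      fix k
      have fin: "finite {U. U \<in> conn_sets T1 \<and> card (boundary T1 U) = card (leaves T1)}"
          "finite {U. U \<in> conn_sets T2 \<and> card (boundary T2 U) = card (leaves T2)}"
        using t1.finite_verts t2.finite_verts by (auto simp: conn_sets_def)
      have "card {U \<in> conn_sets T1. card U = k \<and> card (boundary T1 U) = card (leaves T1)} =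
          card {U \<in> conn_sets T2. card U = k \<and> card (boundary T2 U) = card (leaves T1)}"
      \<comment> \<open>The coloring argument covers \<open>k \<ge> 1\<close>; size 0 is settled by
        the fact that connected sets are nonempty.\<close>
      proof (cases "k = 0")
        case True
        have "card U \<noteq> 0" if "U \<in> conn_sets T1" for U using t1.conn_setsD[OF that] by simp
        moreover have "card U \<noteq> 0" if "U \<in> conn_sets T2" for U using t2.conn_setsD[OF that] by simp
        ultimately have "{U \<in> conn_sets T1. card U = k \<and> card (boundary T1 U) = card (leaves T1)} = {}"
          "{U \<in> conn_sets T2. card U = k \<and> card (boundary T2 U) = card (leaves T1)} = {}" using True by auto
        then show ?thesis by (simp only: card.empty)
      next
        case False
        then show ?thesis by (intro N) simp
      qed
      then show "coeff (\<Sum>U | U \<in> conn_sets T1 \<and> card (boundary T1 U) = card (leaves T1). [:0, 1::int:] ^ card U) k =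
          coeff (\<Sum>U | U \<in> conn_sets T2 \<and> card (boundary T2 U) = card (leaves T2). [:0, 1:] ^ card U) k"
        unfolding coeff_sum_X_power[OF fin(1)] coeff_sum_X_power[OF fin(2)]
        using L by (simp add: conj_ac)
    qed
    then show "[:0, 1::int:] ^ (0 + card t1.core) * (\<Prod>l\<in>leaves T1. \<Sum>j<t1.arm_length l. [:0, 1:] ^ j) =
        [:0, 1:] ^ (0 + card t2.core) * (\<Prod>l\<in>leaves T2. \<Sum>j<t2.arm_length l. [:0, 1:] ^ j)"
      unfolding t1.boundary_generating_function[OF n2 b(1)] t2.boundary_generating_function[OF n2[unfolded n] b(2)]
        add_0 .
  qed
qed

theorem theorem3:
  fixes T1 :: "'a ugraph" and T2 :: "'b ugraph"
  assumes "is_tree T1" and "is_tree T2"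
  shows "(subtree_poly T1 = subtree_poly T2 \<longrightarrow>
           card (verts (trunk T1)) = card (verts (trunk T2)) \<and>
           twig_lengths T1 = twig_lengths T2 \<and>
           (\<forall>i\<ge>1. card {P \<in> twigs T1. card (edges P) = i} = card {P \<in> twigs T2. card (edges P) = i}))
       \<and> (chromatic_symmetric T1 = chromatic_symmetric T2 \<longrightarrow>
           card (verts (trunk T1)) = card (verts (trunk T2)) \<and>
           twig_lengths T1 = twig_lengths T2 \<and>
           (\<forall>i\<ge>1. card {P \<in> twigs T1. card (edges P) = i} = card {P \<in> twigs T2. card (edges P) = i}))"
  using subtree_poly_determines[OF assms] chromatic_symmetric_determines_trunk_twigs[OF assms]
  by (simp add: count_twig_lengths[OF assms(1)] count_twig_lengths[OF assms(2)])

end
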